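(* Let $f\in\mathrm{Sym}\,\mathbb{R}\langle\underline{X}\rangle$ and $S=\{g_1,\dots,g_m\}\subseteq\mathrm{Sym}\,\mathbb{R}\langle\underline{X}\rangle$, and let $d$, $\lambda_{\hat d}(f,S)$, $\lambda^{\mathrm{ts}}_{\hat d,k}(f,S)$, $\lambda^{\mathrm{ts}}_{\hat d,\circ}(f,S)$, $(\mathrm{EQ}^{\mathrm{ts}}_{\hat d,k})$ and $(\mathrm{EQ}^{\mathrm{ts}}_{\hat d,k})^*$ be as in the context. Then: (i) if $S$ is feasible (there exist $r\ge1$ and real symmetric $r\times r$ matrices $A_1,\dots,A_n$ with $g_j(A_1,\dots,A_n)\succeq0$ for all $j$) and $g_1=R^2-\sum_{i=1}^nX_i^2$ for some $R>0$, then for all $\hat d\ge d$ and $k\ge1$ there is no duality gap between $(\mathrm{EQ}^{\mathrm{ts}}_{\hat d,k})$ and $(\mathrm{EQ}^{\mathrm{ts}}_{\hat d,k})^*$; (ii) for each fixed $\hat d\ge d$, the sequence $(\lambda^{\mathrm{ts}}_{\hat d,k}(f,S))_{k\ge1}$ is monotone nondecreasing and $\lambda^{\mathrm{ts}}_{\hat d,k}(f,S)\le\lambda_{\hat d}(f,S)$ for all $k$; (iii) for each fixed $k\ge1$, the sequence $(\lambda^{\mathrm{ts}}_{\hat d,k}(f,S))_{\hat d\ge d}$ is monotone nondecreasing; (iv) if the maximal chordal extension is used to define the graphs $G^{(k)}_{\hat d,j}$, then for each $\hat d\ge d$ the sequence $(\lambda^{\mathrm{ts}}_{\hat d,k}(f,S))_{k\ge1}$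 reaches $\lambda_{\hat d}(f,S)$ after finitely many steps, i.e. $\lambda^{\mathrm{ts}}_{\hat d,\circ}(f,S)=\lambda_{\hat d}(f,S)$.
   Context: Let $n\ge1$ and $\underline{X}=(X_1,\dots,X_n)$ be noncommuting letters. $\langle\underline{X}\rangle$ denotes the set of all finite words in $X_1,\dots,X_n$, including the empty word $1$; $\mathbb{R}\langle\underline{X}\rangle$ is the real algebra with basis $\langle\underline{X}\rangle$. The involution $\star$ fixes $\mathbb{R}$ and each $X_i$ and reverses words; $\mathrm{Sym}\,\mathbb{R}\langle\underline{X}\rangle=\{f:f^\star=f\}$. For $f=\sum_wa_ww$, $\mathrm{supp}(f)=\{w:a_w\ne0\}$, $a_w$ is the coefficient of $w$ in $f$, and $\deg(f)$ is the maximal length of a word in $\mathrm{supp}(f)$. $\mathbf{W}_d$ is the set of words of length at most $d$ (ordered lexicographically), and $\mathbf{W}_d^2=\{u^\star u:u\in\mathbf{W}_d\}$. For $\mathbf{y}=(y_w)_{w\in\langle\underline{X}\rangle}$, $L_{\mathbf{y}}(\sum_wa_ww)=\sum_wa_wy_w$; $M_d(\mathbf{y})$ is the matrix indexed by $\mathbf{W}_d$ with $(u,v)$-entry $y_{u^\star v}$; for $g=\sum_wb_ww\in\mathrm{Sym}\,\mathbb{R}\langle\underline{X}\rangle$, the localizing matrix $M_d(g\mathbf{y})$ is indexed by $\mathbf{W}_d$ with $(u,v)$-entry $\sum_wb_wy_{u^\star wv}$. Write $M_{\hat d-d_j}(g_j\mathbf{y})=\sum_wD^j_wy_w$ with appropriate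 symmetric matrices $D^j_w$; $\delta_{1w}$ is the Kronecker delta; $\langle P,Q\rangle=\mathrm{Tr}(P^TQ)$. Graphs: all graphs are simple undirected with words as nodes. For a graph $G$ with node set $V$, $B_G$ is its adjacency matrix with ones on the diagonal, $\circ$ the Hadamard product, $\mathbb{S}_G$ the space of real symmetric $V\times V$ matrices $Q$ with $Q_{uv}=0$ whenever $u\neq v$ and $\{u,v\}\notin E(G)$, $\Pi_G$ the projection onto $\mathbb{S}_G$ (keep diagonal and edge entries, zero the rest), and $\Pi_G(\mathbb{S}^{|V|}_+)=\{\Pi_G(Q):Q\succeq0\}$. $G\subseteq H$ means $V(G)\subseteq V(H)$ and $E(G)\subseteq E(H)$. A chordal extension $\overline{G}$ of $G$ is a chordal graph (every cycle of length $\ge4$ has a chord) on the same nodes containing $G$; a fixed rule $G\mapsto\overline{G}$ is used throughout, assumed to satisfy $G\subseteq H\Rightarrow\overline{G}\subseteq\overline{H}$. The maximal chordal extension makes each connected component complete. For a graph $G$ and $g\in\mathbb{R}\langle\underline{X}\rangle$, $\mathrm{supp}_g(G)=\{u^\star wv:\{u,v\}\in E(G),\ w\in\mathrm{supp}(g)\}$. Setup: $\mathbf{A}=\mathrm{supp}(f)\cup\bigcup_{j=1}^m\mathrm{supp}(g_j)$, $g_0=1$, $d_j=\lceil\deg(g_j)/2\rceil$ for $j=0,\dots,m$, $d=\max\{\lceil\deg(f)/2\rceil,d_1,\dots,d_m\}$, and $\hat d\ge d$ is the relaxation order; $r_j=|\mathbf{W}_{\hat d-d_j}|$. The tsp graph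 $G^{(0)}_{\hat d,0}$ has nodes $\mathbf{W}_{\hat d}$ and edges $\{u,v\}$, $u\neq v$, $u^\star v\in\mathbf{A}\cup\mathbf{W}^2_{\hat d}$; for $j\in\{1,\dots,m\}$, $G^{(0)}_{\hat d,j}$ is the graph on $\mathbf{W}_{\hat d-d_j}$ with no edges. For $k\ge1$ and $j\in\{0,\dots,m\}$, $F^{(k)}_{\hat d,j}$ is the graph on $\mathbf{W}_{\hat d-d_j}$ with edges $\{u,v\}$, $u\ne v$, such that $\{u^\star wv: w\in\mathrm{supp}(g_j)\}\cap\big(\bigcup_{i=0}^m\mathrm{supp}_{g_i}(G^{(k-1)}_{\hat d,i})\cup\mathbf{W}^2_{\hat d}\big)\ne\emptyset$, and $G^{(k)}_{\hat d,j}=\overline{F^{(k)}_{\hat d,j}}$. These increase in $k$ and stabilize to graphs $G^{(\circ)}_{\hat d,j}$. $(\mathrm{EQ}^{\mathrm{ts}}_{\hat d,k})$: $\lambda^{\mathrm{ts}}_{\hat d,k}(f,S)=\inf L_{\mathbf{y}}(f)$ s.t. $B_{G^{(k)}_{\hat d,0}}\circ M_{\hat d}(\mathbf{y})\in\Pi_{G^{(k)}_{\hat d,0}}(\mathbb{S}^{r_0}_+)$, $B_{G^{(k)}_{\hat d,j}}\circ M_{\hat d-d_j}(g_j\mathbf{y})\in\Pi_{G^{(k)}_{\hat d,j}}(\mathbb{S}^{r_j}_+)$ for $j=1,\dots,m$, $y_1=1$. $\lambda^{\mathrm{ts}}_{\hat d,\circ}(f,S)$ is the same with the stabilized graphs $G^{(\circ)}_{\hat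 d,j}$. $(\mathrm{EQ}^{\mathrm{ts}}_{\hat d,k})^*$: $\sup\lambda$ s.t. $\sum_{j=0}^m\langle Q_j,D^j_w\rangle+\lambda\delta_{1w}=a_w$ for all $w\in\bigcup_{j=0}^m\mathrm{supp}_{g_j}(G^{(k)}_{\hat d,j})\cup\mathbf{W}^2_{\hat d}$, $Q_j\in\mathbb{S}^{r_j}_+\cap\mathbb{S}_{G^{(k)}_{\hat d,j}}$ for $j=0,\dots,m$. The dense relaxation is $\lambda_{\hat d}(f,S)=\inf\{L_{\mathbf{y}}(f): M_{\hat d}(\mathbf{y})\succeq0,\ M_{\hat d-d_j}(g_j\mathbf{y})\succeq0\ (j=1,\dots,m),\ y_1=1\}$.
   Formalization: supp_g(G) is taken to include the diagonal words u*wu for nodes u of G, not only u*wv for edges {u,v}; this enters the graphs F^(k) and the dual constraints. With edges only, (i) fails, e.g. f=-Y^2, g_1=4-X^2-Y^2, g_2=X-1, relaxation order 2, k=1. *)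

theory Defs
  imports "HOL-Library.Extended_Real"
begin

text \<open>Letters X_1..X_n are encoded as the naturals 0..n-1; a word is a list of letters
  (the empty list is the empty word 1). A noncommutative polynomial is its coefficient
  function word => real (with finite support over the n letters).\<close>

type_synonym word = "nat list"
type_synonym ncpoly = "word \<Rightarrow> real"
type_synonym wgraph = "word set \<times> word set set"

definition supp :: "ncpoly \<Rightarrow> word set" where
  "supp p = {w. p w \<noteq> 0}"

definition is_ncpoly :: "nat \<Rightarrow> ncpoly \<Rightarrow> bool" where
  "is_ncpoly n p \<longleftrightarrow> finite (supp p) \<and> (\<forall>w\<in>supp p. set w \<subseteq> {..<n})"

text \<open>Membership in Sym R<X>: the involution fixes coefficients and reverses words.\<close>
definition is_sym :: "ncpoly \<Rightarrow> bool" where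
  "is_sym p \<longleftrightarrow> (\<forall>w. p (rev w) = p w)"

definition deg :: "ncpoly \<Rightarrow> nat" where
  "deg p = Max (insert 0 (length ` supp p))"

definition ncone :: ncpoly where
  "ncone = (\<lambda>w. if w = [] then 1 else 0)"

definition words_upto :: "nat \<Rightarrow> nat \<Rightarrow> word set" where
  "words_upto n k = {w. length w \<le> k \<and> set w \<subseteq> {..<n}}"

definition sq_words :: "nat \<Rightarrow> nat \<Rightarrow> word set" where
  "sq_words n k = {rev u @ u | u. u \<in> words_upto n k}"

definition Lfun :: "(word \<Rightarrow> real) \<Rightarrow> ncpoly \<Rightarrow> real" where
  "Lfun y p = (\<Sum>w\<in>supp p. p w * y w)"

definition momat :: "(word \<Rightarrow> real) \<Rightarrow> word \<Rightarrow> word \<Rightarrow> real" where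
  "momat y u v = y (rev u @ v)"

definition locmat :: "ncpoly \<Rightarrow> (word \<Rightarrow> real) \<Rightarrow> word \<Rightarrow> word \<Rightarrow> real" where
  "locmat g y u v = (\<Sum>w\<in>supp g. g w * y (rev u @ w @ v))"

definition psd_on :: "'a set \<Rightarrow> ('a \<Rightarrow> 'a \<Rightarrow> real) \<Rightarrow> bool" where
  "psd_on V Q \<longleftrightarrow> (\<forall>u\<in>V. \<forall>v\<in>V. Q u v = Q v u) \<and>
     (\<forall>x. (\<Sum>u\<in>V. \<Sum>v\<in>V. x u * Q u v * x v) \<ge> 0)"

definition mmul :: "nat \<Rightarrow> (nat \<Rightarrow> nat \<Rightarrow> real) \<Rightarrow> (nat \<Rightarrow> nat \<Rightarrow> real) \<Rightarrow> nat \<Rightarrow> nat \<Rightarrow> real" where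
  "mmul r P Q i k = (\<Sum>l<r. P i l * Q l k)"

definition idm :: "nat \<Rightarrow> nat \<Rightarrow> real" where
  "idm i k = (if i = k then 1 else 0)"

definition weval :: "nat \<Rightarrow> (nat \<Rightarrow> nat \<Rightarrow> nat \<Rightarrow> real) \<Rightarrow> word \<Rightarrow> nat \<Rightarrow> nat \<Rightarrow> real" where
  "weval r A w = foldr (\<lambda>a M. mmul r (A a) M) w idm"

definition peval :: "nat \<Rightarrow> (nat \<Rightarrow> nat \<Rightarrow> nat \<Rightarrow> real) \<Rightarrow> ncpoly \<Rightarrow> nat \<Rightarrow> nat \<Rightarrow> real" where
  "peval r A p = (\<lambda>i k. \<Sum>w\<in>supp p. p w * weval r A w i k)"

definition feasible :: "nat \<Rightarrow> (nat \<Rightarrow> ncpoly) \<Rightarrow> nat \<Rightarrow> bool" where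
  "feasible n g m \<longleftrightarrow> (\<exists>r\<ge>1. \<exists>A. (\<forall>i<n. \<forall>a<r. \<forall>b<r. A i a b = A i b a) \<and>
       (\<forall>j\<in>{1..m}. psd_on {..<r} (peval r A (g j))))"

definition ball_poly :: "nat \<Rightarrow> real \<Rightarrow> ncpoly" where
  "ball_poly n R = (\<lambda>w. if w = [] then R^2 else if (\<exists>i<n. w = [i, i]) then -1 else 0)"

definition graph_wf :: "wgraph \<Rightarrow> bool" where
  "graph_wf G \<longleftrightarrow> finite (fst G) \<and>
     (\<forall>e\<in>snd G. \<exists>u v. e = {u, v} \<and> u \<noteq> v \<and> u \<in> fst G \<and> v \<in> fst G)"

definition subgraph :: "wgraph \<Rightarrow> wgraph \<Rightarrow> bool" where
  "subgraph G H \<longleftrightarrow> fst G \<subseteq> fst H \<and> snd G \<subseteq> snd H"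

definition chordal :: "wgraph \<Rightarrow> bool" where
  "chordal G \<longleftrightarrow> (\<forall>cs. distinct cs \<and> length cs \<ge> 4 \<and> set cs \<subseteq> fst G \<and>
      (\<forall>i<length cs. {cs ! i, cs ! ((i + 1) mod length cs)} \<in> snd G) \<longrightarrow>
      (\<exists>i<length cs. \<exists>j<length cs. i \<noteq> j \<and> j \<noteq> (i + 1) mod length cs \<and>
          i \<noteq> (j + 1) mod length cs \<and> {cs ! i, cs ! j} \<in> snd G))"

definition is_chordal_ext :: "wgraph \<Rightarrow> wgraph \<Rightarrow> bool" where
  "is_chordal_ext G H \<longleftrightarrow> graph_wf H \<and> fst H = fst G \<and> snd G \<subseteq> snd H \<and> chordal H"

definition chordal_ext_rule :: "(wgraph \<Rightarrow> wgraph) \<Rightarrow> bool" where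
  "chordal_ext_rule ext \<longleftrightarrow> (\<forall>G. graph_wf G \<longrightarrow> is_chordal_ext G (ext G)) \<and>
     (\<forall>G H. graph_wf G \<longrightarrow> graph_wf H \<longrightarrow> subgraph G H \<longrightarrow> subgraph (ext G) (ext H))"

definition max_chordal_ext :: "wgraph \<Rightarrow> wgraph" where
  "max_chordal_ext G = (fst G, {{u, v} | u v. u \<in> fst G \<and> v \<in> fst G \<and> u \<noteq> v \<and>
       (u, v) \<in> ({(a, b). {a, b} \<in> snd G})\<^sup>*})"

definition gsupp :: "ncpoly \<Rightarrow> wgraph \<Rightarrow> word set" where
  "gsupp g G = {rev u @ w @ v | u w v. ((u = v \<and> u \<in> fst G) \<or> {u, v} \<in> snd G) \<and> w \<in> supp g}"

definition gpoly :: "(nat \<Rightarrow> ncpoly) \<Rightarrow> nat \<Rightarrow> ncpoly" where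
  "gpoly g j = (if j = 0 then ncone else g j)"

definition dj :: "(nat \<Rightarrow> ncpoly) \<Rightarrow> nat \<Rightarrow> nat" where
  "dj g j = (deg (gpoly g j) + 1) div 2"

definition dmin :: "ncpoly \<Rightarrow> (nat \<Rightarrow> ncpoly) \<Rightarrow> nat \<Rightarrow> nat" where
  "dmin f g m = Max (insert ((deg f + 1) div 2) ((\<lambda>j. dj g j) ` {1..m}))"

definition Aset :: "ncpoly \<Rightarrow> (nat \<Rightarrow> ncpoly) \<Rightarrow> nat \<Rightarrow> word set" where
  "Aset f g m = supp f \<union> (\<Union>j\<in>{1..m}. supp (g j))"

definition conmat :: "(nat \<Rightarrow> ncpoly) \<Rightarrow> nat \<Rightarrow> (word \<Rightarrow> real) \<Rightarrow> word \<Rightarrow> word \<Rightarrow> real" where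
  "conmat g j y = (if j = 0 then momat y else locmat (g j) y)"

definition tsp_graph :: "nat \<Rightarrow> ncpoly \<Rightarrow> (nat \<Rightarrow> ncpoly) \<Rightarrow> nat \<Rightarrow> nat \<Rightarrow> wgraph" where
  "tsp_graph n f g m dh = (words_upto n dh,
     {{u, v} | u v. u \<in> words_upto n dh \<and> v \<in> words_upto n dh \<and> u \<noteq> v \<and>
        rev u @ v \<in> Aset f g m \<union> sq_words n dh})"

definition init_graph :: "nat \<Rightarrow> ncpoly \<Rightarrow> (nat \<Rightarrow> ncpoly) \<Rightarrow> nat \<Rightarrow> nat \<Rightarrow> nat \<Rightarrow> wgraph" where
  "init_graph n f g m dh j =
     (if j = 0 then tsp_graph n f g m dh else (words_upto n (dh - dj g j), {}))"

definition Fgraph :: "nat \<Rightarrow> (nat \<Rightarrow> ncpoly) \<Rightarrow> nat \<Rightarrow> nat \<Rightarrow> (nat \<Rightarrow> wgraph) \<Rightarrow> nat \<Rightarrow> wgraph" where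
  "Fgraph n g m dh Gs j = (words_upto n (dh - dj g j),
     {{u, v} | u v. u \<in> words_upto n (dh - dj g j) \<and> v \<in> words_upto n (dh - dj g j) \<and> u \<noteq> v \<and>
        (\<exists>w\<in>supp (gpoly g j).
            rev u @ w @ v \<in> (\<Union>i\<in>{0..m}. gsupp (gpoly g i) (Gs i)) \<union> sq_words n dh)})"

fun tsgraph :: "(wgraph \<Rightarrow> wgraph) \<Rightarrow> nat \<Rightarrow> ncpoly \<Rightarrow> (nat \<Rightarrow> ncpoly) \<Rightarrow> nat \<Rightarrow> nat \<Rightarrow> nat \<Rightarrow> nat \<Rightarrow> wgraph" where
  "tsgraph ext n f g m dh 0 j = init_graph n f g m dh j"
| "tsgraph ext n f g m dh (Suc k) j = ext (Fgraph n g m dh (tsgraph ext n f g m dh k) j)"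

definition stab_index :: "(wgraph \<Rightarrow> wgraph) \<Rightarrow> nat \<Rightarrow> ncpoly \<Rightarrow> (nat \<Rightarrow> ncpoly) \<Rightarrow> nat \<Rightarrow> nat \<Rightarrow> nat" where
  "stab_index ext n f g m dh = (LEAST K. \<forall>k\<ge>K. \<forall>j\<in>{0..m}.
       tsgraph ext n f g m dh k j = tsgraph ext n f g m dh K j)"

definition primal_val :: "nat \<Rightarrow> ncpoly \<Rightarrow> (nat \<Rightarrow> ncpoly) \<Rightarrow> nat \<Rightarrow> (nat \<Rightarrow> wgraph) \<Rightarrow> ereal" where
  "primal_val n f g m Gs = Inf {ereal (Lfun y f) | y. y [] = 1 \<and>
     (\<forall>j\<in>{0..m}. \<exists>Q. psd_on (fst (Gs j)) Q \<and>
        (\<forall>u\<in>fst (Gs j). \<forall>v\<in>fst (Gs j). (u = v \<or> {u, v} \<in> snd (Gs j)) \<longrightarrow>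
            Q u v = conmat g j y u v))}"

text \<open>D^j_w: coefficient matrix of y_w in M_{dh-d_j}(g_j y).\<close>
definition Dmat :: "(nat \<Rightarrow> ncpoly) \<Rightarrow> nat \<Rightarrow> word \<Rightarrow> word \<Rightarrow> word \<Rightarrow> real" where
  "Dmat g j w u v = (\<Sum>w'\<in>supp (gpoly g j). if rev u @ w' @ v = w then gpoly g j w' else 0)"

definition dual_val :: "nat \<Rightarrow> ncpoly \<Rightarrow> (nat \<Rightarrow> ncpoly) \<Rightarrow> nat \<Rightarrow> nat \<Rightarrow> (nat \<Rightarrow> wgraph) \<Rightarrow> ereal" where
  "dual_val n f g m dh Gs = Sup {ereal lam | lam. \<exists>Q.
     (\<forall>j\<in>{0..m}. psd_on (fst (Gs j)) (Q j) \<and>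
        (\<forall>u\<in>fst (Gs j). \<forall>v\<in>fst (Gs j). u \<noteq> v \<and> {u, v} \<notin> snd (Gs j) \<longrightarrow> Q j u v = 0)) \<and>
     (\<forall>w\<in>(\<Union>j\<in>{0..m}. gsupp (gpoly g j) (Gs j)) \<union> sq_words n dh.
        (\<Sum>j=0..m. \<Sum>u\<in>fst (Gs j). \<Sum>v\<in>fst (Gs j). Q j u v * Dmat g j w u v)
          + lam * (if w = [] then 1 else 0) = f w)}"

definition dense_val :: "nat \<Rightarrow> ncpoly \<Rightarrow> (nat \<Rightarrow> ncpoly) \<Rightarrow> nat \<Rightarrow> nat \<Rightarrow> ereal" where
  "dense_val n f g m dh = Inf {ereal (Lfun y f) | y. y [] = 1 \<and>
     (\<forall>j\<in>{0..m}. psd_on (words_upto n (dh - dj g j)) (conmat g j y))}"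

definition lam_ts :: "(wgraph \<Rightarrow> wgraph) \<Rightarrow> nat \<Rightarrow> ncpoly \<Rightarrow> (nat \<Rightarrow> ncpoly) \<Rightarrow> nat \<Rightarrow> nat \<Rightarrow> nat \<Rightarrow> ereal" where
  "lam_ts ext n f g m dh k = primal_val n f g m (tsgraph ext n f g m dh k)"

definition lam_ts_dual :: "(wgraph \<Rightarrow> wgraph) \<Rightarrow> nat \<Rightarrow> ncpoly \<Rightarrow> (nat \<Rightarrow> ncpoly) \<Rightarrow> nat \<Rightarrow> nat \<Rightarrow> nat \<Rightarrow> ereal" where
  "lam_ts_dual ext n f g m dh k = dual_val n f g m dh (tsgraph ext n f g m dh k)"

definition lam_ts_circ :: "(wgraph \<Rightarrow> wgraph) \<Rightarrow> nat \<Rightarrow> ncpoly \<Rightarrow> (nat \<Rightarrow> ncpoly) \<Rightarrow> nat \<Rightarrow> nat \<Rightarrow> ereal" where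
  "lam_ts_circ ext n f g m dh =
     primal_val n f g m (tsgraph ext n f g m dh (stab_index ext n f g m dh))"

end

theory Submission
  imports Defs "HOL-Library.Function_Algebras"
begin

text \<open>
  Parts (ii) and (iii) hold because a larger pattern graph imposes more constraints.

  For (iv), let the graphs be fixed by the iteration with the maximal chordal extension and let
  \<open>y\<close> be feasible. Put \<open>y\<^sub>w = 0\<close> for every word \<open>w\<close> outside the pattern. The objective does not change,
  and the full moment and localizing matrices become block diagonal along the connected
  components, each block being a principal submatrix of a positive semidefinite completion.

  For (i), weak duality is \<open>\<langle>P, Q\<rangle> \<ge> 0\<close> for positive semidefinite \<open>P\<close>, \<open>Q\<close>. For the converse consider
  the cone of tuples of matrices that are positive semidefinite modulo the tuples annihilated by the
  dual constraints. The ball constraint \<open>g\<^sub>1 = R\<^sup>2 - \<Sum>X\<^sub>i\<^sup>2\<close> makes the matrix unit at the empty word an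
  order unit: modulo the constraints \<open>E\<^bsub>X\<^sub>iu,X\<^sub>iu\<^esub> \<le> R\<^sup>2 E\<^bsub>u,u\<^esub>\<close>, and diagonal entries dominate all others.
  If \<open>f - \<lambda>\<close> is not in the cone, a normalised positive functional is nonpositive there; it vanishes
  on the annihilated tuples, so on the pattern it is a moment sequence, and its values at all matrix units
  form a positive semidefinite completion. Hence the primal value is at most \<open>\<lambda>\<close>. No closedness
  argument is needed.
\<close>

section \<open>Cones with an order unit\<close>

text \<open>Tuples of matrices are curried functions; with the pointwise structure,
  \<open>linear\<close> and the cone lemmas apply to them directly.\<close>

instantiation "fun" :: (type, real_vector) real_vector
begin

definition scaleR_fun_def: "a *\<^sub>R f = (\<lambda>x. a *\<^sub>R f x)"

instance
  by standard (auto simp: scaleR_fun_def plus_fun_def scaleR_add_right scaleR_add_left)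

end

lemma scaleR_fun_apply [simp]: "(a *\<^sub>R f) x = a *\<^sub>R f x"
  by (simp add: scaleR_fun_def)

definition is_cone :: "'v::real_vector set \<Rightarrow> bool" where
  "is_cone C \<longleftrightarrow> 0 \<in> C \<and> (\<forall>x\<in>C. \<forall>y\<in>C. x + y \<in> C) \<and> (\<forall>x\<in>C. \<forall>t\<ge>0. t *\<^sub>R x \<in> C)"

lemma is_cone_0: "is_cone C \<Longrightarrow> 0 \<in> C"
  and is_cone_add: "is_cone C \<Longrightarrow> x \<in> C \<Longrightarrow> y \<in> C \<Longrightarrow> x + y \<in> C"
  and is_cone_scaleR: "is_cone C \<Longrightarrow> x \<in> C \<Longrightarrow> t \<ge> 0 \<Longrightarrow> t *\<^sub>R x \<in> C"
  by (auto simp: is_cone_def)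

lemma is_cone_sum:
  assumes "is_cone C" "\<And>i. i \<in> I \<Longrightarrow> x i \<in> C"
  shows "sum x I \<in> C"
  using assms(2) by (induction I rule: infinite_finite_induct)
    (auto intro: is_cone_add is_cone_0 assms(1))

text \<open>Adjoining one ray is the single step of the maximality argument below.\<close>

lemma is_cone_extend:
  assumes "is_cone C"
  shows "is_cone {c + s *\<^sub>R v | c s. c \<in> C \<and> s \<ge> 0}" (is "is_cone ?X")
    and "C \<subseteq> {c + s *\<^sub>R v | c s. c \<in> C \<and> s \<ge> 0}"
    and "v \<in> {c + s *\<^sub>R v | c s. c \<in> C \<and> s \<ge> 0}"
proof -
  have add: "x + y \<in> ?X" if xX: "x \<in> ?X" and yX: "y \<in> ?X" for x y
  proof -
    obtain c s where x: "x = c + s *\<^sub>R v" "c \<in> C" "s \<ge> 0"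
      using xX by blast
    obtain c' s' where y: "y = c' + s' *\<^sub>R v" "c' \<in> C" "s' \<ge> 0"
      using yX by blast
    have "x + y = (c + c') + (s + s') *\<^sub>R v"
      using x(1) y(1) by (simp add: algebra_simps)
    moreover have "c + c' \<in> C" "s + s' \<ge> 0"
      using x y is_cone_add[OF assms] by auto
    ultimately show ?thesis by blast
  qed
  have scale: "t *\<^sub>R x \<in> ?X" if xX: "x \<in> ?X" and t: "t \<ge> 0" for x t
  proof -
    obtain c s where x: "x = c + s *\<^sub>R v" "c \<in> C" "s \<ge> 0"
      using xX by blast
    have "t *\<^sub>R x = t *\<^sub>R c + (t * s) *\<^sub>R v"
      using x(1) by (simp add: algebra_simps)
    moreover have "t *\<^sub>R c \<in> C" "t * s \<ge> 0"
      using x t is_cone_scaleR[OF assms] by auto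
    ultimately show ?thesis by blast
  qed
  show sub: "C \<subseteq> ?X"
  proof
    fix c assume "c \<in> C"
    then have "c = c + 0 *\<^sub>R v \<and> c \<in> C \<and> (0::real) \<le> 0" by simp
    then show "c \<in> ?X" by blast
  qed
  have "v = 0 + 1 *\<^sub>R v \<and> 0 \<in> C \<and> (0::real) \<le> 1"
    using is_cone_0[OF assms] by simp
  then show "v \<in> ?X" by blast
  show "is_cone ?X"
    unfolding is_cone_def using sub is_cone_0[OF assms] add scale by blast
qed

text \<open>The cone is a total preorder in which multiples of \<open>e\<close> bound every vector,
  so the \<open>r\<close> with \<open>v - r e\<close> in \<open>C\<close> form a Dedekind cut of the
  reals. The cut point is the value of the functional at \<open>v\<close>; it is additive because
  cuts add.\<close>

lemma total_cone_functional:
  fixes e :: "'v::real_vector"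
  assumes C: "is_cone C" and e: "e \<in> C" "- e \<notin> C"
    and total: "\<And>v. v \<in> C \<or> - v \<in> C"
    and unit: "\<And>v. \<exists>t. t *\<^sub>R e + v \<in> C"
  shows "\<exists>m::'v \<Rightarrow> real. linear m \<and> (\<forall>x\<in>C. m x \<ge> 0) \<and> m e = 1"
proof -
  note add = is_cone_add[OF C] and scl = is_cone_scaleR[OF C]
  have e_iff: "r *\<^sub>R e \<in> C \<longleftrightarrow> r \<ge> 0" for r
  proof
    assume r: "r *\<^sub>R e \<in> C"
    show "r \<ge> 0"
    proof (rule ccontr)
      assume "\<not> r \<ge> 0"
      then have "(1 / (- r)) *\<^sub>R (r *\<^sub>R e) \<in> C" and "r \<noteq> 0"
        using scl[OF r, of "1 / (- r)"] by auto
      then show False using e(2) by simp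
    qed
  qed (use scl e(1) in blast)
  \<comment> \<open>Only strict inequalities: \<open>C\<close> may fail to be closed, so membership
    at \<open>r = a\<close> itself stays undecided.\<close>
  define H where "H v a \<longleftrightarrow> (\<forall>r<a. v - r *\<^sub>R e \<in> C) \<and> (\<forall>r>a. r *\<^sub>R e - v \<in> C)" for v a
  have H_le: "a \<le> b" if Ha: "H v a" and Hb: "H v b" for v a b
  proof (rule ccontr)
    assume "\<not> a \<le> b"
    then obtain r s where rs: "b < r" "r < s" "s < a"
      by (meson dense not_le)
    then have "(v - s *\<^sub>R e) + (r *\<^sub>R e - v) \<in> C"
      using Ha Hb unfolding H_def by (intro add) auto
    then have "(r - s) *\<^sub>R e \<in> C" by (simp add: algebra_simps)
    then show False using rs e_iff by auto
  qed
  have H_unique: "a = b" if "H v a" "H v b" for v a b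
    using H_le[of v a b] H_le[of v b a] that by simp
  have H_exists: "\<exists>a. H v a" for v
  proof -
    let ?S = "{r. v - r *\<^sub>R e \<in> C}"
    obtain t where t: "t *\<^sub>R e + v \<in> C" using unit by blast
    obtain t' where t': "t' *\<^sub>R e + - v \<in> C" using unit by blast
    have ne: "- t \<in> ?S" using t by (simp add: algebra_simps)
    have "r \<le> t'" if "r \<in> ?S" for r
    proof -
      have "(v - r *\<^sub>R e) + (t' *\<^sub>R e + - v) \<in> C" using that t' add by blast
      then have "(t' - r) *\<^sub>R e \<in> C" by (simp add: algebra_simps)
      then show ?thesis using e_iff by simp
    qed
    then have bdd: "bdd_above ?S" by (auto simp: bdd_above_def)
    have "v - r *\<^sub>R e \<in> C" if "r < Sup ?S" for r
    proof -
      obtain s where s: "s \<in> ?S" "r < s"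
        using less_cSup_iff[of ?S r] ne bdd \<open>r < Sup ?S\<close> by blast
      have "(v - s *\<^sub>R e) + (s - r) *\<^sub>R e \<in> C"
        using s e_iff by (intro add) auto
      then show ?thesis by (simp add: algebra_simps)
    qed
    moreover have "r *\<^sub>R e - v \<in> C" if "r > Sup ?S" for r
    proof -
      have "r \<notin> ?S" using cSup_upper[OF _ bdd, of r] that by auto
      then show ?thesis using total[of "v - r *\<^sub>R e"] by simp
    qed
    ultimately show ?thesis unfolding H_def by blast
  qed
  define m where "m v = (THE a. H v a)" for v
  have mI: "m v = a" if "H v a" for v a
    unfolding m_def using that H_unique by blast
  have Hm: "H v (m v)" for v
    using H_exists mI by metis
  have m_add: "m (u + v) = m u + m v" for u v
  proof (rule mI, unfold H_def, intro conjI allI impI)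
    fix r assume "r < m u + m v"
    \<comment> \<open>The deficit \<open>m u + m v - r\<close> is shared equally between
      \<open>u\<close> and \<open>v\<close>.\<close>
    then obtain a b where ab: "a < m u" "b < m v" "r = a + b"
      by (intro that[of "(r + m u - m v) / 2" "(r + m v - m u) / 2"]) (auto simp: field_simps)
    have "(u - a *\<^sub>R e) + (v - b *\<^sub>R e) \<in> C"
      using Hm[of u] Hm[of v] ab unfolding H_def by (intro add) auto
    then show "u + v - r *\<^sub>R e \<in> C" unfolding ab(3) by (simp add: algebra_simps)
  next
    fix r assume "r > m u + m v"
    then obtain a b where ab: "a > m u" "b > m v" "r = a + b"
      by (intro that[of "(r + m u - m v) / 2" "(r + m v - m u) / 2"]) (auto simp: field_simps)
    have "(a *\<^sub>R e - u) + (b *\<^sub>R e - v) \<in> C"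
      using Hm[of u] Hm[of v] ab unfolding H_def by (intro add) auto
    then show "r *\<^sub>R e - (u + v) \<in> C" unfolding ab(3) by (simp add: algebra_simps)
  qed
  have m_pos: "m (c *\<^sub>R v) = c * m v" if c: "c > 0" for c v
  proof (rule mI, unfold H_def, intro conjI allI impI)
    fix r assume "r < c * m v"
    then have "r / c < m v" using c by (simp add: field_simps)
    then have "c *\<^sub>R (v - (r / c) *\<^sub>R e) \<in> C"
      using Hm[of v] c unfolding H_def by (intro scl) auto
    then show "c *\<^sub>R v - r *\<^sub>R e \<in> C" using c by (simp add: algebra_simps)
  next
    fix r assume "r > c * m v"
    then have "r / c > m v" using c by (simp add: field_simps)
    then have "c *\<^sub>R ((r / c) *\<^sub>R e - v) \<in> C"
      using Hm[of v] c unfolding H_def by (intro scl) auto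
    then show "r *\<^sub>R e - c *\<^sub>R v \<in> C" using c by (simp add: algebra_simps)
  qed
  have m_0: "m 0 = 0" using m_add[of 0 0] by simp
  have m_minus: "m (- v) = - m v" for v
    using m_add[of v "- v"] m_0 by simp
  have m_scl: "m (c *\<^sub>R v) = c * m v" for c v
  proof (cases c "0::real" rule: linorder_cases)
    case less
    then have "m (- ((- c) *\<^sub>R v)) = - ((- c) * m v)"
      using m_pos[of "- c" v] m_minus[of "(- c) *\<^sub>R v"] by simp
    then show ?thesis by simp
  qed (auto simp: m_0 m_pos)
  have "linear m"
    by (rule linearI) (auto simp: m_add m_scl)
  moreover have "m x \<ge> 0" if x: "x \<in> C" for x
  proof (rule ccontr)
    assume neg: "\<not> m x \<ge> 0"
    \<comment> \<open>As \<open>m x\<close> is negative, \<open>m x / 2\<close> lies strictly above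
      the cut of \<open>x\<close>; adding \<open>x\<close> then puts a negative multiple of
      \<open>e\<close> into \<open>C\<close>.\<close>
    then have "(m x / 2) *\<^sub>R e - x \<in> C" using Hm[of x] unfolding H_def by auto
    then have "(m x / 2) *\<^sub>R e \<in> C" using add[OF _ x] by force
    then show False using neg e_iff by simp
  qed
  moreover have "m e = 1"
  proof (rule mI, unfold H_def, intro conjI allI impI)
    fix r :: real assume "r < 1"
    then show "e - r *\<^sub>R e \<in> C" using e_iff[of "1 - r"] by (simp add: algebra_simps)
  next
    fix r :: real assume "r > 1"
    then show "r *\<^sub>R e - e \<in> C" using e_iff[of "r - 1"] by (simp add: algebra_simps)
  qed
  ultimately show ?thesis by blast
qed

text \<open>An order unit replaces the topological hypotheses of the separation theorem:
  a cone that contains \<open>W\<close> and \<open>- z\<close> and is maximal among those avoiding \<open>- e\<close> is total.\<close>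

lemma cone_separation_order_unit:
  fixes e z :: "'v::real_vector"
  assumes W: "is_cone W" and e: "e \<in> W" and unit: "\<And>v. \<exists>t. t *\<^sub>R e + v \<in> W"
    and z: "z \<notin> W"
  shows "\<exists>m::'v \<Rightarrow> real. linear m \<and> (\<forall>x\<in>W. m x \<ge> 0) \<and> m e = 1 \<and> m z \<le> 0"
proof -
  note add = is_cone_add[OF W] and scl = is_cone_scaleR[OF W]
  \<comment> \<open>Otherwise \<open>W\<close> contains every multiple of \<open>e\<close>, and
    removing \<open>t e\<close> from \<open>t e + z\<close> yields \<open>z\<close>.\<close>
  have "- e \<notin> W"
  proof
    assume me: "- e \<in> W"
    obtain t where t: "t *\<^sub>R e + z \<in> W" using unit by blast
    have "(- t) *\<^sub>R e \<in> W"
      using scl[OF me, of t] scl[OF e, of "- t"] by (cases "t \<ge> 0") auto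
    then have "(t *\<^sub>R e + z) + (- t) *\<^sub>R e \<in> W" using t add by blast
    then show False using z by simp
  qed
  define A where "A = {C. is_cone C \<and> W \<subseteq> C \<and> - z \<in> C \<and> - e \<notin> C}"
  let ?C0 = "{c + s *\<^sub>R (- z) | c s. c \<in> W \<and> s \<ge> 0}"
  have "- e \<notin> ?C0"
  proof
    assume "- e \<in> ?C0"
    then obtain c s where cs: "- e = c + s *\<^sub>R (- z)" "c \<in> W" "s \<ge> 0" by blast
    have "s \<noteq> 0" using cs \<open>- e \<notin> W\<close> by auto
    have "s *\<^sub>R z = c + e" using cs(1) by (simp add: algebra_simps)
    then have "(1 / s) *\<^sub>R (s *\<^sub>R z) \<in> W" using cs e add scl by simp
    then show False using z \<open>s \<noteq> 0\<close> by simp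
  qed
  then have "?C0 \<in> A"
    unfolding A_def using is_cone_extend[OF W, of "- z"] by blast
  then have "A \<noteq> {}" by blast
  moreover have "\<Union>\<C> \<in> A" if ne: "\<C> \<noteq> {}" and ch: "subset.chain A \<C>" for \<C>
  proof -
    have sub: "\<C> \<subseteq> A" and lin: "\<And>X Y. X \<in> \<C> \<Longrightarrow> Y \<in> \<C> \<Longrightarrow> X \<subseteq> Y \<or> Y \<subseteq> X"
      using ch unfolding subset.chain_def by auto
    have add: "x + y \<in> \<Union>\<C>" if "x \<in> \<Union>\<C>" "y \<in> \<Union>\<C>" for x y
    proof -
      obtain X Y where XY: "X \<in> \<C>" "Y \<in> \<C>" "x \<in> X" "y \<in> Y"
        using \<open>x \<in> \<Union>\<C>\<close> \<open>y \<in> \<Union>\<C>\<close> by blast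
      then obtain Z where "Z \<in> \<C>" "x \<in> Z" "y \<in> Z" using lin[of X Y] by blast
      then show ?thesis using sub is_cone_add[of Z x y] unfolding A_def by blast
    qed
    have scl: "t *\<^sub>R x \<in> \<Union>\<C>" if "x \<in> \<Union>\<C>" "t \<ge> 0" for t x
      using that sub is_cone_scaleR[of _ x t] unfolding A_def by blast
    have "0 \<in> \<Union>\<C>"
      using ne sub is_cone_0 unfolding A_def by blast
    then have "is_cone (\<Union>\<C>)" unfolding is_cone_def using add scl by blast
    then show ?thesis using ne sub unfolding A_def by blast
  qed
  ultimately obtain C where C: "C \<in> A" and max: "\<And>X. X \<in> A \<Longrightarrow> C \<subseteq> X \<Longrightarrow> X = C"
    using subset_Zorn_nonempty[of A] by metis
  have cone: "is_cone C" and WC: "W \<subseteq> C" and zC: "- z \<in> C" and eC: "- e \<notin> C"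
    using C unfolding A_def by auto
  \<comment> \<open>By maximality, adjoining an outside vector must break the one condition that can
    fail, namely that \<open>- e\<close> stays out.\<close>
  have escape: "\<exists>c\<in>C. \<exists>s>0. c + s *\<^sub>R v = - e" if v: "v \<notin> C" for v
  proof -
    let ?X = "{c + s *\<^sub>R v | c s. c \<in> C \<and> s \<ge> 0}"
    have "?X \<noteq> C" using is_cone_extend(3)[OF cone, of v] v by blast
    then have "?X \<notin> A" using max[OF _ is_cone_extend(2)[OF cone]] by blast
    then have "- e \<in> ?X"
      unfolding A_def using is_cone_extend(1,2)[OF cone, of v] WC zC by blast
    then obtain c s where cs: "- e = c + s *\<^sub>R v" "c \<in> C" "s \<ge> 0" by blast
    then have "s \<noteq> 0" using eC by auto
    then show ?thesis using cs by (intro bexI[of _ c] exI[of _ s]) auto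
  qed
  have total: "v \<in> C \<or> - v \<in> C" for v
  proof (rule ccontr)
    assume neg: "\<not> (v \<in> C \<or> - v \<in> C)"
    obtain c s where cs: "c \<in> C" "s > 0" "c + s *\<^sub>R v = - e" using escape neg by blast
    obtain c' s' where cs': "c' \<in> C" "s' > 0" "c' + s' *\<^sub>R (- v) = - e" using escape neg by blast
    \<comment> \<open>The weights cancel \<open>v\<close> between the two representations of
      \<open>- e\<close>, which leaves \<open>- e\<close> itself in \<open>C\<close>.\<close>
    have "(s' / (s + s')) *\<^sub>R c + (s / (s + s')) *\<^sub>R c' \<in> C"
      using cs cs' by (intro is_cone_add[OF cone] is_cone_scaleR[OF cone]) auto
    moreover have "c = - e - s *\<^sub>R v" "c' = - e + s' *\<^sub>R v"
      using cs(3) cs'(3) by (auto simp: algebra_simps)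
    then have "(s' / (s + s')) *\<^sub>R c + (s / (s + s')) *\<^sub>R c' = - ((s' / (s + s') + s / (s + s')) *\<^sub>R e)"
      by (simp only:) (simp add: algebra_simps)
    moreover have "s' / (s + s') + s / (s + s') = 1"
      using cs(2) cs'(2) by (simp add: add_divide_distrib[symmetric])
    ultimately show False using eC by simp
  qed
  obtain m :: "'v \<Rightarrow> real" where m: "linear m" "\<forall>x\<in>C. m x \<ge> 0" "m e = 1"
    using total_cone_functional[OF cone _ eC total] e WC unit by (metis subsetD)
  moreover have "m z \<le> 0"
    using m zC by (metis linear_neg neg_0_le_iff_le)
  ultimately show ?thesis using WC by blast
qed

text \<open>Induction on \<open>I\<close>: on the common kernel of the other functionals,
  \<open>m\<close> is a multiple \<open>k\<close> of \<open>\<phi> a\<close>, and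
  \<open>m - k \<phi> a\<close> falls under the induction hypothesis. Later this turns vanishing on
  null tuples into multipliers, which become the moments.\<close>

lemma functional_in_span_of_common_kernel:
  fixes \<phi> :: "'i \<Rightarrow> 'v::real_vector \<Rightarrow> real"
  assumes "finite I" "\<And>i. i \<in> I \<Longrightarrow> linear (\<phi> i)" "linear m"
    and "\<And>x. (\<And>i. i \<in> I \<Longrightarrow> \<phi> i x = 0) \<Longrightarrow> m x = 0"
  shows "\<exists>c. \<forall>x. m x = (\<Sum>i\<in>I. c i * \<phi> i x)"
  using assms
proof (induction I arbitrary: m rule: finite_induct)
  case empty
  then show ?case by simp
next
  case (insert a I)
  have lin: "linear (\<phi> a)" using insert.prems by auto
  have *: "\<exists>k. \<forall>x. (\<forall>i\<in>I. \<phi> i x = 0) \<longrightarrow> m x - k * \<phi> a x = 0"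
  proof (cases "\<exists>x. (\<forall>i\<in>I. \<phi> i x = 0) \<and> \<phi> a x \<noteq> 0")
    case True
    then obtain e where e: "\<forall>i\<in>I. \<phi> i e = 0" "\<phi> a e \<noteq> 0" by blast
    have "m x - (m e / \<phi> a e) * \<phi> a x = 0" if x: "\<forall>i\<in>I. \<phi> i x = 0" for x
    proof -
      \<comment> \<open>Moving along \<open>e\<close> kills \<open>\<phi> a\<close> and keeps the
        others zero, so this vector lies in the full common kernel.\<close>
      let ?y = "x - (\<phi> a x / \<phi> a e) *\<^sub>R e"
      have "\<phi> i ?y = 0" if "i \<in> insert a I" for i
        using that x e insert.prems(1)[OF that]
        by (auto simp: linear_diff linear_scale)
      then have "m ?y = 0" using insert.prems(3) by blast
      then show ?thesis using insert.prems(2) by (simp add: linear_diff linear_scale)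
    qed
    then show ?thesis by blast
  next
    case False
    then have "m x = 0" if "\<forall>i\<in>I. \<phi> i x = 0" for x
      using that insert.prems(3)[of x] by auto
    then show ?thesis by (intro exI[of _ 0]) auto
  qed
  then obtain k where k: "\<And>x. (\<forall>i\<in>I. \<phi> i x = 0) \<Longrightarrow> m x - k * \<phi> a x = 0" by blast
  have "linear (\<lambda>x. m x - k * \<phi> a x)"
    using insert.prems(2) lin by (intro linearI) (auto simp: linear_add linear_scale algebra_simps)
  then obtain c where c: "\<And>x. m x - k * \<phi> a x = (\<Sum>i\<in>I. c i * \<phi> i x)"
    using insert.IH[of "\<lambda>x. m x - k * \<phi> a x"] insert.prems(1) k by auto
  have "m x = (\<Sum>i\<in>insert a I. (c(a := k)) i * \<phi> i x)" for x
  proof -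
    have "(\<Sum>i\<in>I. (c(a := k)) i * \<phi> i x) = (\<Sum>i\<in>I. c i * \<phi> i x)"
      using insert.hyps by (intro sum.cong) auto
    then show ?thesis using c[of x] insert.hyps by simp
  qed
  then show ?case by blast
qed

section \<open>Positive semidefinite matrices on finite index sets\<close>

lemma psd_on_form: "psd_on V Q \<Longrightarrow> 0 \<le> (\<Sum>u\<in>V. \<Sum>v\<in>V. x u * Q u v * x v)"
  unfolding psd_on_def by blast

lemma psd_on_subset:
  assumes "psd_on V Q" "finite V" "U \<subseteq> V"
  shows "psd_on U Q"
  unfolding psd_on_def
proof (intro conjI ballI allI)
  show "Q u v = Q v u" if "u \<in> U" "v \<in> U" for u v
    using assms that unfolding psd_on_def by blast
  fix x :: "'a \<Rightarrow> real"
  let ?x = "\<lambda>u. if u \<in> U then x u else 0"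
  have "(\<Sum>u\<in>V. \<Sum>v\<in>V. ?x u * Q u v * ?x v) = (\<Sum>u\<in>V. \<Sum>v\<in>U. ?x u * Q u v * ?x v)"
    using assms by (intro sum.cong[OF refl] sum.mono_neutral_right) auto
  also have "\<dots> = (\<Sum>u\<in>U. \<Sum>v\<in>U. ?x u * Q u v * ?x v)"
    using assms by (intro sum.mono_neutral_right) auto
  also have "\<dots> = (\<Sum>u\<in>U. \<Sum>v\<in>U. x u * Q u v * x v)"
    by (intro sum.cong) auto
  finally show "0 \<le> (\<Sum>u\<in>U. \<Sum>v\<in>U. x u * Q u v * x v)"
    using psd_on_form[OF assms(1), of ?x] by simp
qed

lemma psd_on_add:
  assumes "psd_on V P" "psd_on V Q"
  shows "psd_on V (P + Q)"
  unfolding psd_on_def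
proof (intro conjI ballI allI)
  show "(P + Q) u v = (P + Q) v u" if "u \<in> V" "v \<in> V" for u v
    using assms that unfolding psd_on_def by simp
  fix x
  have "(\<Sum>u\<in>V. \<Sum>v\<in>V. x u * (P + Q) u v * x v) =
      (\<Sum>u\<in>V. \<Sum>v\<in>V. x u * P u v * x v) + (\<Sum>u\<in>V. \<Sum>v\<in>V. x u * Q u v * x v)"
    by (simp add: sum.distrib algebra_simps)
  then show "0 \<le> (\<Sum>u\<in>V. \<Sum>v\<in>V. x u * (P + Q) u v * x v)"
    using psd_on_form[OF assms(1), of x] psd_on_form[OF assms(2), of x] by simp
qed

lemma psd_on_scaleR:
  assumes "psd_on V Q" "t \<ge> 0"
  shows "psd_on V (t *\<^sub>R Q)"
  unfolding psd_on_def
proof (intro conjI ballI allI)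
  show "(t *\<^sub>R Q) u v = (t *\<^sub>R Q) v u" if "u \<in> V" "v \<in> V" for u v
    using assms that unfolding psd_on_def by simp
  fix x
  have "(\<Sum>u\<in>V. \<Sum>v\<in>V. x u * (t *\<^sub>R Q) u v * x v) = t * (\<Sum>u\<in>V. \<Sum>v\<in>V. x u * Q u v * x v)"
    by (simp add: sum_distrib_left algebra_simps)
  then show "0 \<le> (\<Sum>u\<in>V. \<Sum>v\<in>V. x u * (t *\<^sub>R Q) u v * x v)"
    using psd_on_form[OF assms(1), of x] assms(2) by simp
qed

lemma psd_on_cong:
  assumes "\<And>u v. u \<in> V \<Longrightarrow> v \<in> V \<Longrightarrow> Q u v = Q' u v"
  shows "psd_on V Q \<longleftrightarrow> psd_on V Q'"
  using assms unfolding psd_on_def by (simp cong: sum.cong)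

text \<open>The form at a vector with \<open>a\<close>-coordinate \<open>t\<close> is quadratic in
  \<open>t\<close>; minimising over \<open>t\<close> gives the Schur complement. If
  \<open>Q a a = 0\<close>, row \<open>a\<close> vanishes and the convention
  \<open>x / 0 = 0\<close> turns the formula into \<open>Q\<close> itself.\<close>

lemma psd_on_schur_complement:
  assumes psd: "psd_on (insert a V) Q" and V: "finite V" "a \<notin> V"
  shows "psd_on V (\<lambda>u v. Q u v - Q a u * Q a v / Q a a)"
    and "v \<in> V \<Longrightarrow> Q a a = 0 \<Longrightarrow> Q a v = 0" and "Q a a \<ge> 0"
proof -
  have sym: "Q u v = Q v u" if "u \<in> insert a V" "v \<in> insert a V" for u v
    using psd that unfolding psd_on_def by blast
  define s where "s x = (\<Sum>v\<in>V. Q a v * x v)" for x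
  have form: "0 \<le> t\<^sup>2 * Q a a + 2 * t * s x + (\<Sum>u\<in>V. \<Sum>v\<in>V. x u * Q u v * x v)" for t x
  proof -
    let ?x = "x(a := t)"
    have "(\<Sum>u\<in>insert a V. \<Sum>v\<in>insert a V. ?x u * Q u v * ?x v) =
        t * Q a a * t + (\<Sum>v\<in>V. t * Q a v * ?x v) +
        (\<Sum>u\<in>V. ?x u * Q u a * t + (\<Sum>v\<in>V. ?x u * Q u v * ?x v))"
      using V by simp
    also have "\<dots> = t * Q a a * t + (\<Sum>v\<in>V. t * Q a v * x v) +
        (\<Sum>u\<in>V. x u * Q u a * t + (\<Sum>v\<in>V. x u * Q u v * x v))"
      using V by (intro arg_cong2[of _ _ _ _ "(+)"] sum.cong refl) auto
    also have "(\<Sum>v\<in>V. t * Q a v * x v) = t * s x"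
      by (simp add: s_def sum_distrib_left mult_ac)
    also have "(\<Sum>u\<in>V. x u * Q u a * t + (\<Sum>v\<in>V. x u * Q u v * x v)) =
        t * s x + (\<Sum>u\<in>V. \<Sum>v\<in>V. x u * Q u v * x v)"
      using sym by (simp add: s_def sum.distrib sum_distrib_left mult_ac cong: sum.cong)
    finally have "(\<Sum>u\<in>insert a V. \<Sum>v\<in>insert a V. ?x u * Q u v * ?x v) =
        t\<^sup>2 * Q a a + 2 * t * s x + (\<Sum>u\<in>V. \<Sum>v\<in>V. x u * Q u v * x v)"
      by (simp add: power2_eq_square algebra_simps)
    then show ?thesis using psd_on_form[OF psd, of ?x] by simp
  qed
  show qaa: "Q a a \<ge> 0"
    using form[of 1 "\<lambda>_. 0"] by (simp add: s_def)
  have s0: "s x = 0" if "Q a a = 0" for x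
  proof (rule ccontr)
    assume s: "s x \<noteq> 0"
    define c where "c = (\<Sum>u\<in>V. \<Sum>v\<in>V. x u * Q u v * x v)"
    \<comment> \<open>With \<open>Q a a = 0\<close> the form is affine in \<open>t\<close>; this
      choice of \<open>t\<close> makes it -1.\<close>
    have "0 \<le> 2 * (- (c + 1) / (2 * s x)) * s x + c"
      using form[of "- (c + 1) / (2 * s x)" x] that unfolding c_def by simp
    also have "\<dots> = -1" using s by (simp add: field_simps)
    finally show False by simp
  qed
  show "Q a v = 0" if v: "v \<in> V" and "Q a a = 0"
  proof -
    have "s (\<lambda>u. if u = v then 1 else 0) = Q a v"
      unfolding s_def using v V by (simp add: if_distrib cong: if_cong)
    then show ?thesis using s0 \<open>Q a a = 0\<close> by metis
  qed
  show "psd_on V (\<lambda>u v. Q u v - Q a u * Q a v / Q a a)"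
    unfolding psd_on_def
  proof (intro conjI ballI allI)
    show "Q u v - Q a u * Q a v / Q a a = Q v u - Q a v * Q a u / Q a a"
      if "u \<in> V" "v \<in> V" for u v
      using sym that by auto
    fix x
    let ?c = "\<Sum>u\<in>V. \<Sum>v\<in>V. x u * Q u v * x v"
    have "(\<Sum>u\<in>V. \<Sum>v\<in>V. x u * (Q u v - Q a u * Q a v / Q a a) * x v) =
        ?c - (\<Sum>u\<in>V. \<Sum>v\<in>V. (Q a u * x u) * (Q a v * x v)) / Q a a"
      by (simp add: algebra_simps sum_subtractf sum_divide_distrib)
    also have "(\<Sum>u\<in>V. \<Sum>v\<in>V. (Q a u * x u) * (Q a v * x v)) = (s x)\<^sup>2"
      by (simp add: s_def power2_eq_square sum_product)
    finally have eq: "(\<Sum>u\<in>V. \<Sum>v\<in>V. x u * (Q u v - Q a u * Q a v / Q a a) * x v) =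
        ?c - (s x)\<^sup>2 / Q a a" .
    show "0 \<le> (\<Sum>u\<in>V. \<Sum>v\<in>V. x u * (Q u v - Q a u * Q a v / Q a a) * x v)"
    proof (cases "Q a a = 0")
      case True
      then show ?thesis using eq form[of 0 x] by simp
    next
      case False
      \<comment> \<open>The minimiser of the quadratic is \<open>t = - s x / Q a a\<close>.\<close>
      then have "0 \<le> ?c - (s x)\<^sup>2 / Q a a"
        using form[of "- s x / Q a a" x] by (simp add: field_simps power2_eq_square)
      then show ?thesis unfolding eq .
    qed
  qed
qed

text \<open>Induction by eliminating one index of \<open>Q\<close>: the rank-one part contributes
  the form of \<open>P\<close> at row \<open>a\<close> of \<open>Q\<close>, divided by the pivot,
  and the Schur complement goes to the induction hypothesis.\<close>

lemma psd_on_inner_product_nonneg: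
  assumes "finite V" "psd_on V P" "psd_on V Q"
  shows "(\<Sum>u\<in>V. \<Sum>v\<in>V. Q u v * P u v) \<ge> 0"
  using assms
proof (induction V arbitrary: Q rule: finite_induct)
  case empty
  then show ?case by simp
next
  case (insert a V)
  note schur = psd_on_schur_complement[OF insert.prems(2) insert.hyps]
  define Q' where "Q' u v = Q u v - Q a u * Q a v / Q a a" for u v
  have sym: "Q u a = Q a u" if "u \<in> insert a V" for u
    using insert.prems(2) that unfolding psd_on_def by blast
  \<comment> \<open>In the degenerate case \<open>Q a a = 0\<close> this holds because row
    \<open>a\<close> of \<open>Q\<close> is already zero.\<close>
  have row: "Q' a v = 0" "Q' v a = 0" if "v \<in> insert a V" for v
    using that schur(2)[of v] sym[of v] by (cases "Q a a = 0"; auto simp: Q'_def)+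
  let ?I = "insert a V"
  have IH: "(\<Sum>u\<in>V. \<Sum>v\<in>V. Q' u v * P u v) \<ge> 0"
    using insert.IH psd_on_subset[OF insert.prems(1), of V] schur(1) insert.hyps
    unfolding Q'_def by auto
  have "(\<Sum>u\<in>?I. \<Sum>v\<in>?I. Q u v * P u v) =
      (\<Sum>u\<in>?I. \<Sum>v\<in>?I. Q' u v * P u v) + (\<Sum>u\<in>?I. \<Sum>v\<in>?I. Q a u * P u v * Q a v) / Q a a"
    by (simp add: Q'_def sum_divide_distrib sum.distrib[symmetric] algebra_simps
        del: sum.insert)
  also have "(\<Sum>u\<in>?I. \<Sum>v\<in>?I. Q' u v * P u v) = (\<Sum>u\<in>V. \<Sum>v\<in>V. Q' u v * P u v)"
    using row insert.hyps by (simp cong: sum.cong)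
  also have "0 \<le> (\<Sum>u\<in>V. \<Sum>v\<in>V. Q' u v * P u v) + (\<Sum>u\<in>?I. \<Sum>v\<in>?I. Q a u * P u v * Q a v) / Q a a"
    using IH schur(3) insert.prems(1) unfolding psd_on_def
    by (intro add_nonneg_nonneg divide_nonneg_nonneg) blast+
  finally show ?case .
qed

text \<open>The form of the block-diagonal part at \<open>x\<close> is the sum, over the classes
  \<open>C\<close>, of the form of \<open>Q\<close> at \<open>x\<close> cut down to
  \<open>C\<close>.\<close>

lemma psd_on_block_diagonal:
  assumes V: "finite V" and psd: "psd_on V Q" and R: "equiv V R"
  shows "psd_on V (\<lambda>u v. if (u, v) \<in> R then Q u v else 0)"
  unfolding psd_on_def
proof (intro conjI ballI allI)
  have symR: "(u, v) \<in> R \<longleftrightarrow> (v, u) \<in> R" for u v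
    using R unfolding equiv_def sym_def by blast
  show "(if (u, v) \<in> R then Q u v else 0) = (if (v, u) \<in> R then Q v u else 0)"
    if "u \<in> V" "v \<in> V" for u v
    using psd that symR[of u v] unfolding psd_on_def by simp
  fix x :: "'a \<Rightarrow> real"
  let ?x = "\<lambda>C u. if u \<in> C then x u else 0"
  have fin: "finite (V // R)" using V R by (simp add: finite_quotient equiv_type)
  \<comment> \<open>Only the class of \<open>u\<close> can contribute, and it does so exactly when
    it contains \<open>v\<close>.\<close>
  have ind: "(\<Sum>C\<in>V // R. ?x C u * q * ?x C v) = x u * (if (u, v) \<in> R then q else 0) * x v"
    if uv: "u \<in> V" "v \<in> V" for u v and q :: real
  proof -
    have eq: "u \<in> C \<longleftrightarrow> C = R `` {u}" if "C \<in> V // R" for C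
      using that R uv by (metis Image_singleton_iff equiv_class_eq equiv_class_self quotientE)
    have "(\<Sum>C\<in>V // R. ?x C u * q * ?x C v) =
        (\<Sum>C\<in>V // R. if C = R `` {u} then x u * q * ?x C v else 0)"
      using eq by (intro sum.cong) auto
    also have "\<dots> = x u * q * ?x (R `` {u}) v"
      using fin uv by (simp add: quotientI)
    finally show ?thesis by auto
  qed
  have "0 \<le> (\<Sum>C\<in>V // R. \<Sum>u\<in>V. \<Sum>v\<in>V. ?x C u * Q u v * ?x C v)"
  proof (rule sum_nonneg)
    fix C
    show "0 \<le> (\<Sum>u\<in>V. \<Sum>v\<in>V. ?x C u * Q u v * ?x C v)"
      by (rule psd_on_form[OF psd])
  qed
  also have "\<dots> = (\<Sum>u\<in>V. \<Sum>C\<in>V // R. \<Sum>v\<in>V. ?x C u * Q u v * ?x C v)"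
    by (rule sum.swap)
  also have "\<dots> = (\<Sum>u\<in>V. \<Sum>v\<in>V. \<Sum>C\<in>V // R. ?x C u * Q u v * ?x C v)"
    by (intro sum.cong refl sum.swap)
  also have "\<dots> = (\<Sum>u\<in>V. \<Sum>v\<in>V. x u * (if (u, v) \<in> R then Q u v else 0) * x v)"
    using ind by (intro sum.cong refl) blast
  finally show "0 \<le> (\<Sum>u\<in>V. \<Sum>v\<in>V. x u * (if (u, v) \<in> R then Q u v else 0) * x v)" .
qed

section \<open>Monotonicity and stabilisation of the graphs\<close>

text \<open>The growth properties of an extension rule, isolated so that arbitrary chordal rules and
  \<open>max_chordal_ext\<close> share the lemmas below.\<close>

definition monotone_ext :: "(wgraph \<Rightarrow> wgraph) \<Rightarrow> bool" where
  "monotone_ext ext \<longleftrightarrow>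
     (\<forall>G. graph_wf G \<longrightarrow> graph_wf (ext G) \<and> fst (ext G) = fst G \<and> snd G \<subseteq> snd (ext G)) \<and>
     (\<forall>G H. graph_wf G \<longrightarrow> graph_wf H \<longrightarrow> subgraph G H \<longrightarrow> subgraph (ext G) (ext H))"

lemma chordal_ext_rule_imp_monotone_ext: "chordal_ext_rule ext \<Longrightarrow> monotone_ext ext"
  unfolding chordal_ext_rule_def monotone_ext_def is_chordal_ext_def by blast

lemma monotone_ext_max_chordal_ext: "monotone_ext max_chordal_ext"
  unfolding monotone_ext_def
proof (intro conjI allI impI)
  fix G :: wgraph assume G: "graph_wf G"
  show "graph_wf (max_chordal_ext G)"
    using G unfolding graph_wf_def max_chordal_ext_def by auto
  show "fst (max_chordal_ext G) = fst G"
    by (simp add: max_chordal_ext_def)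
  show "snd G \<subseteq> snd (max_chordal_ext G)"
  proof
    fix e assume e: "e \<in> snd G"
    then obtain u v where uv: "e = {u, v}" "u \<noteq> v" "u \<in> fst G" "v \<in> fst G"
      using G unfolding graph_wf_def by blast
    then have "(u, v) \<in> {(a, b). {a, b} \<in> snd G}\<^sup>*"
      using e by auto
    then show "e \<in> snd (max_chordal_ext G)"
      using uv unfolding max_chordal_ext_def by auto
  qed
next
  fix G H :: wgraph assume sub: "subgraph G H"
  have "{(a, b). {a, b} \<in> snd G}\<^sup>* \<subseteq> {(a, b). {a, b} \<in> snd H}\<^sup>*"
    using sub by (intro rtrancl_mono) (auto simp: subgraph_def)
  then show "subgraph (max_chordal_ext G) (max_chordal_ext H)"
    using sub unfolding subgraph_def max_chordal_ext_def by auto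
qed

section \<open>Words, degrees and supports\<close>

lemma supp_ncone [simp]: "supp ncone = {[]}"
  by (auto simp: supp_def ncone_def)

lemma gpoly_0 [simp]: "gpoly g 0 = ncone"
  and gpoly_pos: "j \<noteq> 0 \<Longrightarrow> gpoly g j = g j"
  by (auto simp: gpoly_def)

lemma dj_0 [simp]: "dj g 0 = 0"
  by (simp add: dj_def deg_def)

lemma finite_words_upto [simp]: "finite (words_upto n k)"
proof -
  have "words_upto n k = {w. set w \<subseteq> {..<n} \<and> length w \<le> k}"
    by (auto simp: words_upto_def)
  then show ?thesis using finite_lists_length_le[of "{..<n}" k] by simp
qed

lemma words_upto_mono: "k \<le> l \<Longrightarrow> words_upto n k \<subseteq> words_upto n l"
  by (auto simp: words_upto_def)

lemma sq_words_mono: "k \<le> l \<Longrightarrow> sq_words n k \<subseteq> sq_words n l"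
  using words_upto_mono[of k l n] by (auto simp: sq_words_def)

lemma Nil_in_sq_words [simp]: "[] \<in> sq_words n k"
  by (force simp: sq_words_def words_upto_def)

text \<open>Cutting after \<open>k\<close> letters shows that every word of length at most
  \<open>2 * k\<close> labels an entry of the moment matrix of order \<open>k\<close>.\<close>

lemma words_upto_split:
  assumes "length w \<le> 2 * k" "set w \<subseteq> {..<n}"
  obtains a b where "a \<in> words_upto n k" "b \<in> words_upto n k" "w = rev a @ b"
proof (rule that[of "rev (take k w)" "drop k w"])
  show "rev (take k w) \<in> words_upto n k" "drop k w \<in> words_upto n k"
    using assms set_take_subset[of k w] set_drop_subset[of k w] by (auto simp: words_upto_def)
qed simp

lemma length_le_deg: "is_ncpoly n p \<Longrightarrow> w \<in> supp p \<Longrightarrow> length w \<le> deg p"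
  unfolding deg_def is_ncpoly_def by (intro Max_ge) auto

lemma deg_le_dmin: "deg f \<le> 2 * dmin f g m"
proof -
  have "(deg f + 1) div 2 \<le> dmin f g m"
    unfolding dmin_def by (intro Max_ge) auto
  then show ?thesis by linarith
qed

lemma dj_le_dmin: "j \<in> {0..m} \<Longrightarrow> dj g j \<le> dmin f g m"
  unfolding dmin_def by (cases "j = 0") (auto simp del: Max_insert intro!: Max_ge)

lemma gsupp_mono: "subgraph G H \<Longrightarrow> gsupp p G \<subseteq> gsupp p H"
  unfolding gsupp_def subgraph_def by blast

lemma graph_wf_Fgraph: "graph_wf (Fgraph n g m dh Gs j)"
  unfolding graph_wf_def Fgraph_def by auto

lemma graph_wf_init_graph: "graph_wf (init_graph n f g m dh j)"
  unfolding graph_wf_def init_graph_def tsp_graph_def by auto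

lemma subgraph_refl: "subgraph G G"
  and subgraph_trans: "subgraph G H \<Longrightarrow> subgraph H K \<Longrightarrow> subgraph G K"
  unfolding subgraph_def by auto

lemma Fgraph_mono:
  assumes "dh \<le> dh'" "\<And>i. i \<in> {0..m} \<Longrightarrow> subgraph (Gs i) (Hs i)"
  shows "subgraph (Fgraph n g m dh Gs j) (Fgraph n g m dh' Hs j)"
proof -
  let ?T = "(\<Union>i\<in>{0..m}. gsupp (gpoly g i) (Gs i)) \<union> sq_words n dh"
  let ?T' = "(\<Union>i\<in>{0..m}. gsupp (gpoly g i) (Hs i)) \<union> sq_words n dh'"
  have T: "?T \<subseteq> ?T'"
    using gsupp_mono[OF assms(2)] sq_words_mono[OF assms(1)] by blast
  have V: "words_upto n (dh - dj g j) \<subseteq> words_upto n (dh' - dj g j)"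
    using assms(1) by (intro words_upto_mono) auto
  show ?thesis
    unfolding subgraph_def Fgraph_def fst_conv snd_conv
  proof (intro conjI V subsetI, clarify)
    fix u v w assume "u \<in> words_upto n (dh - dj g j)" "v \<in> words_upto n (dh - dj g j)"
      "u \<noteq> v" "w \<in> supp (gpoly g j)" "rev u @ w @ v \<in> ?T"
    then have "u \<in> words_upto n (dh' - dj g j) \<and> v \<in> words_upto n (dh' - dj g j) \<and> u \<noteq> v \<and>
        (\<exists>w\<in>supp (gpoly g j). rev u @ w @ v \<in> ?T')"
      using V T by blast
    then show "\<exists>u' v'. {u, v} = {u', v'} \<and> u' \<in> words_upto n (dh' - dj g j) \<and>
        v' \<in> words_upto n (dh' - dj g j) \<and> u' \<noteq> v' \<and>
        (\<exists>w\<in>supp (gpoly g j). rev u' @ w @ v' \<in> ?T')"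
      by blast
  qed
qed

lemma subgraph_monotone_ext: "monotone_ext ext \<Longrightarrow> graph_wf G \<Longrightarrow> subgraph G (ext G)"
  unfolding monotone_ext_def subgraph_def by blast

lemma monotone_extD:
  "monotone_ext ext \<Longrightarrow> graph_wf G \<Longrightarrow> graph_wf H \<Longrightarrow> subgraph G H \<Longrightarrow> subgraph (ext G) (ext H)"
  unfolding monotone_ext_def by blast

lemma graph_wf_tsgraph:
  assumes "monotone_ext ext"
  shows "graph_wf (tsgraph ext n f g m dh k j)"
    and "fst (tsgraph ext n f g m dh k j) = words_upto n (dh - dj g j)"
proof -
  have "graph_wf (tsgraph ext n f g m dh k j) \<and>
      fst (tsgraph ext n f g m dh k j) = words_upto n (dh - dj g j)"
  proof (cases k)
    case 0
    then show ?thesis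
      using graph_wf_init_graph by (auto simp: init_graph_def tsp_graph_def)
  next
    case (Suc k')
    then show ?thesis
      using assms graph_wf_Fgraph unfolding monotone_ext_def by (simp add: Fgraph_def)
  qed
  then show "graph_wf (tsgraph ext n f g m dh k j)"
    and "fst (tsgraph ext n f g m dh k j) = words_upto n (dh - dj g j)" by auto
qed

text \<open>Base of the growth in \<open>k\<close>: an edge \<open>{u, v}\<close> of the tsp graph
  puts its own word \<open>rev u @ v\<close> into the support from which \<open>Fgraph\<close> is
  built; for \<open>j \<noteq> 0\<close> there are no edges to lose.\<close>

lemma init_graph_subgraph_Fgraph:
  "subgraph (init_graph n f g m dh j) (Fgraph n g m dh (init_graph n f g m dh) j)"
proof (cases "j = 0")
  case True
  have "rev u @ v \<in> gsupp ncone (init_graph n f g m dh 0)"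
    if "{u, v} \<in> snd (tsp_graph n f g m dh)" for u v
    using that unfolding gsupp_def init_graph_def by force
  then have *: "rev u @ v \<in> (\<Union>i\<in>{0..m}. gsupp (gpoly g i) (init_graph n f g m dh i))"
    if "{u, v} \<in> snd (tsp_graph n f g m dh)" for u v
    using that by (intro UN_I[of 0]) auto
  show ?thesis
    unfolding subgraph_def
  proof (intro conjI subsetI)
    fix e assume "e \<in> snd (init_graph n f g m dh j)"
    then have e: "e \<in> snd (tsp_graph n f g m dh)" using True by (simp add: init_graph_def)
    then obtain u v where uv: "e = {u, v}" "u \<in> words_upto n dh" "v \<in> words_upto n dh" "u \<noteq> v"
      unfolding tsp_graph_def by auto
    then show "e \<in> snd (Fgraph n g m dh (init_graph n f g m dh) j)"
      using *[of u v] e True unfolding Fgraph_def by auto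
  qed (auto simp: True init_graph_def tsp_graph_def Fgraph_def)
qed (auto simp: subgraph_def init_graph_def Fgraph_def)

lemma tsgraph_subgraph_Suc:
  assumes "monotone_ext ext"
  shows "subgraph (tsgraph ext n f g m dh k j) (tsgraph ext n f g m dh (Suc k) j)"
proof (induction k arbitrary: j)
  case 0
  have "tsgraph ext n f g m dh 0 = init_graph n f g m dh" by auto
  then show ?case
    using subgraph_trans[OF init_graph_subgraph_Fgraph
        subgraph_monotone_ext[OF assms graph_wf_Fgraph]] by simp
next
  case (Suc k)
  then show ?case
    by (subst (1 2) tsgraph.simps)
      (intro monotone_extD[OF assms] graph_wf_Fgraph Fgraph_mono; simp)
qed

lemma tsgraph_mono_step:
  assumes "monotone_ext ext" "k \<le> l"
  shows "subgraph (tsgraph ext n f g m dh k j) (tsgraph ext n f g m dh l j)"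
  using assms(2)
proof (induction l rule: dec_induct)
  case (step l)
  then show ?case using tsgraph_subgraph_Suc[OF assms(1)] subgraph_trans by blast
qed (rule subgraph_refl)

text \<open>Raising the order enlarges the vertex sets and \<open>sq_words\<close>, and each
  construction step is monotone in its input. This is the source of (iii).\<close>

lemma tsgraph_mono_order:
  assumes "monotone_ext ext" "dh \<le> dh'"
  shows "subgraph (tsgraph ext n f g m dh k j) (tsgraph ext n f g m dh' k j)"
proof (induction k arbitrary: j)
  case 0
  show ?case
  proof (cases "j = 0")
    case True
    have "words_upto n dh \<subseteq> words_upto n dh'" "sq_words n dh \<subseteq> sq_words n dh'"
      using words_upto_mono sq_words_mono assms(2) by auto
    then show ?thesis
      using True unfolding subgraph_def by (auto simp: init_graph_def tsp_graph_def)
  next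
    case False
    then show ?thesis
      using words_upto_mono[of "dh - dj g j" "dh' - dj g j" n] assms(2)
      by (auto simp: subgraph_def init_graph_def)
  qed
next
  case (Suc k)
  then show ?case
    by (simp, intro monotone_extD[OF assms(1)] graph_wf_Fgraph Fgraph_mono assms(2))
qed

text \<open>A completion for the larger graphs restricts to a principal submatrix completing the
  smaller ones, so feasible sets shrink as graphs grow.\<close>

lemma primal_val_mono:
  assumes "\<And>j. j \<in> {0..m} \<Longrightarrow> subgraph (Gs j) (Hs j)" "\<And>j. j \<in> {0..m} \<Longrightarrow> finite (fst (Hs j))"
  shows "primal_val n f g m Gs \<le> primal_val n f g m Hs"
  unfolding primal_val_def
proof (rule Inf_superset_mono, clarify)
  fix y :: "word \<Rightarrow> real"
  assume y: "y [] = 1" and H: "\<forall>j\<in>{0..m}. \<exists>Q. psd_on (fst (Hs j)) Q \<and>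
      (\<forall>u\<in>fst (Hs j). \<forall>v\<in>fst (Hs j). u = v \<or> {u, v} \<in> snd (Hs j) \<longrightarrow> Q u v = conmat g j y u v)"
  have "\<exists>Q. psd_on (fst (Gs j)) Q \<and>
      (\<forall>u\<in>fst (Gs j). \<forall>v\<in>fst (Gs j). u = v \<or> {u, v} \<in> snd (Gs j) \<longrightarrow> Q u v = conmat g j y u v)"
    if j: "j \<in> {0..m}" for j
  proof -
    obtain Q where Q: "psd_on (fst (Hs j)) Q"
      "\<forall>u\<in>fst (Hs j). \<forall>v\<in>fst (Hs j). u = v \<or> {u, v} \<in> snd (Hs j) \<longrightarrow> Q u v = conmat g j y u v"
      using H j by blast
    then have "psd_on (fst (Gs j)) Q"
      using assms[OF j] psd_on_subset unfolding subgraph_def by blast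
    then show ?thesis
      using Q(2) assms(1)[OF j] unfolding subgraph_def by blast
  qed
  then show "\<exists>y'. ereal (Lfun y f) = ereal (Lfun y' f) \<and> y' [] = 1 \<and>
      (\<forall>j\<in>{0..m}. \<exists>Q. psd_on (fst (Gs j)) Q \<and>
      (\<forall>u\<in>fst (Gs j). \<forall>v\<in>fst (Gs j). u = v \<or> {u, v} \<in> snd (Gs j) \<longrightarrow> Q u v = conmat g j y' u v))"
    using y by blast
qed

text \<open>A dense feasible matrix is its own completion.\<close>

lemma primal_val_le_dense_val:
  assumes "\<And>j. j \<in> {0..m} \<Longrightarrow> fst (Gs j) = words_upto n (dh - dj g j)"
  shows "primal_val n f g m Gs \<le> dense_val n f g m dh"
  unfolding primal_val_def dense_val_def
proof (rule Inf_superset_mono, clarify)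
  fix y :: "word \<Rightarrow> real"
  assume "y [] = 1" "\<forall>j\<in>{0..m}. psd_on (words_upto n (dh - dj g j)) (conmat g j y)"
  then show "\<exists>y'. ereal (Lfun y f) = ereal (Lfun y' f) \<and> y' [] = 1 \<and>
      (\<forall>j\<in>{0..m}. \<exists>Q. psd_on (fst (Gs j)) Q \<and>
      (\<forall>u\<in>fst (Gs j). \<forall>v\<in>fst (Gs j). u = v \<or> {u, v} \<in> snd (Gs j) \<longrightarrow> Q u v = conmat g j y' u v))"
    using assms by auto
qed

text \<open>The index set of the equality constraints in \<open>dual_val\<close>.\<close>

definition pattern_words :: "nat \<Rightarrow> (nat \<Rightarrow> ncpoly) \<Rightarrow> nat \<Rightarrow> nat \<Rightarrow> (nat \<Rightarrow> wgraph) \<Rightarrow> word set" where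
  "pattern_words n g m dh Gs = (\<Union>j\<in>{0..m}. gsupp (gpoly g j) (Gs j)) \<union> sq_words n dh"

lemma pattern_wordsI:
  assumes "j \<in> {0..m}" "u = v \<and> u \<in> fst (Gs j) \<or> {u, v} \<in> snd (Gs j)" "w \<in> supp (gpoly g j)"
  shows "rev u @ w @ v \<in> pattern_words n g m dh Gs"
  using assms unfolding pattern_words_def gsupp_def by blast

text \<open>For \<open>j = 0\<close> the graph \<open>Fgraph\<close> tests the single word
  \<open>rev a @ b\<close>, so every factorisation of a pattern word becomes an edge one step later.
  The duality proof relies on this freedom of choice.\<close>

lemma pattern_word_edge_Suc:
  assumes "monotone_ext ext"
    and "rev a @ b \<in> pattern_words n g m dh (tsgraph ext n f g m dh k)"
    and "a \<in> words_upto n dh" "b \<in> words_upto n dh" "a \<noteq> b"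
  shows "{a, b} \<in> snd (tsgraph ext n f g m dh (Suc k) 0)"
proof -
  have "{a, b} \<in> snd (Fgraph n g m dh (tsgraph ext n f g m dh k) 0)"
    using assms(2-) unfolding Fgraph_def pattern_words_def by auto
  then show ?thesis
    using subgraph_monotone_ext[OF assms(1) graph_wf_Fgraph] unfolding subgraph_def tsgraph.simps
    by blast
qed

text \<open>A word of \<open>f\<close> has length at most \<open>2 * dh\<close> and splits as
  \<open>rev a @ b\<close>: if \<open>a = b\<close> it is a square word, otherwise
  \<open>{a, b}\<close> is an edge of the tsp graph and persists.\<close>

lemma supp_subset_pattern_words:
  assumes "monotone_ext ext" "is_ncpoly n f" "dh \<ge> dmin f g m"
  shows "supp f \<subseteq> pattern_words n g m dh (tsgraph ext n f g m dh k)"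
proof
  fix w assume w: "w \<in> supp f"
  have "length w \<le> 2 * dh" "set w \<subseteq> {..<n}"
    using length_le_deg[OF assms(2) w] deg_le_dmin[of f g m] assms(2,3) w
    by (auto simp: is_ncpoly_def)
  then obtain a b where ab: "a \<in> words_upto n dh" "b \<in> words_upto n dh" "w = rev a @ b"
    by (rule words_upto_split)
  show "w \<in> pattern_words n g m dh (tsgraph ext n f g m dh k)"
  proof (cases "a = b")
    case True
    then show ?thesis using ab unfolding pattern_words_def sq_words_def by auto
  next
    case False
    then have "{a, b} \<in> snd (tsgraph ext n f g m dh 0 0)"
      using ab w by (auto simp: init_graph_def tsp_graph_def Aset_def)
    then have "{a, b} \<in> snd (tsgraph ext n f g m dh k 0)"
      using tsgraph_mono_step[OF assms(1), of 0 k] unfolding subgraph_def by blast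
    then have "rev a @ [] @ b \<in> pattern_words n g m dh (tsgraph ext n f g m dh k)"
      by (intro pattern_wordsI[of 0]) auto
    then show ?thesis using ab by simp
  qed
qed

lemma conmat_gpoly: "conmat g j y u v = (\<Sum>w\<in>supp (gpoly g j). gpoly g j w * y (rev u @ w @ v))"
  by (cases "j = 0") (simp_all add: conmat_def momat_def locmat_def gpoly_pos, simp add: ncone_def)

text \<open>At an index \<open>K\<close> of maximal cardinality, later sets contain
  \<open>A K\<close> without having more elements.\<close>

lemma mono_finite_stabilizes:
  fixes A :: "nat \<Rightarrow> 'a set"
  assumes mono: "\<And>k l. k \<le> l \<Longrightarrow> A k \<subseteq> A l" and B: "\<And>k. A k \<subseteq> B" "finite B"
  shows "\<exists>K. \<forall>k\<ge>K. A k = A K"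
proof -
  have "\<exists>K. True \<and> (\<forall>k. True \<longrightarrow> card (A k) \<le> card (A K))"
    by (rule ex_has_greatest_nat[of "\<lambda>_. True" 0 _ "card B + 1"])
      (auto simp: less_Suc_eq_le card_mono[OF B(2,1)])
  then obtain K where K: "\<And>k. card (A k) \<le> card (A K)" by blast
  have "A k = A K" if "k \<ge> K" for k
    using mono[OF that] K[of k] B finite_subset[of "A k" B]
    by (metis card_seteq)
  then show ?thesis by blast
qed

text \<open>Vertex sets are constant and edge sets increase inside a finite power set; as there are
  finitely many \<open>j\<close>, a common index exists.\<close>

lemma tsgraph_stabilizes:
  assumes "monotone_ext ext"
  shows "\<exists>K. \<forall>k\<ge>K. \<forall>j\<in>{0..m}. tsgraph ext n f g m dh k j = tsgraph ext n f g m dh K j"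
proof -
  let ?G = "tsgraph ext n f g m dh"
  have "\<exists>K. \<forall>k\<ge>K. ?G k j = ?G K j" for j
  proof -
    have "snd (?G k j) \<subseteq> Pow (words_upto n (dh - dj g j))" for k
      using graph_wf_tsgraph[OF assms, of n f g m dh k j] unfolding graph_wf_def by fastforce
    then have "\<exists>K. \<forall>k\<ge>K. snd (?G k j) = snd (?G K j)"
      using tsgraph_mono_step[OF assms, of _ _ n f g m dh j] unfolding subgraph_def
      by (intro mono_finite_stabilizes[where B = "Pow (words_upto n (dh - dj g j))"]) auto
    then show ?thesis
      using graph_wf_tsgraph(2)[OF assms, of n f g m dh _ j] by (metis prod_eqI)
  qed
  then obtain K where K: "\<And>j k. k \<ge> K j \<Longrightarrow> ?G k j = ?G (K j) j" by metis
  have "?G k j = ?G (Max (K ` {0..m})) j" if "k \<ge> Max (K ` {0..m})" "j \<in> {0..m}" for k j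
  proof -
    have "K j \<le> Max (K ` {0..m})" using that(2) by (intro Max_ge) auto
    then show ?thesis using K[of j k] K[of j "Max (K ` {0..m})"] that(1) by simp
  qed
  then show ?thesis by blast
qed

text \<open>For a graph fixed by the iteration, non-adjacent words have no entry \<open>y\<^sub>w\<close> with \<open>w\<close> in the
  pattern; setting \<open>y\<close> to zero off the pattern therefore makes the dense matrices block
  diagonal along the connected components.\<close>

lemma dense_val_le_stable_primal_val:
  assumes stable: "\<And>j. j \<in> {0..m} \<Longrightarrow> Gs j = max_chordal_ext (Fgraph n g m dh Gs j)"
    and f: "supp f \<subseteq> pattern_words n g m dh Gs"
  shows "dense_val n f g m dh \<le> primal_val n f g m Gs"
  unfolding primal_val_def dense_val_def
proof (rule Inf_superset_mono, clarify)
  fix y :: "word \<Rightarrow> real"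
  assume y: "y [] = 1" and P: "\<forall>j\<in>{0..m}. \<exists>Q. psd_on (fst (Gs j)) Q \<and>
      (\<forall>u\<in>fst (Gs j). \<forall>v\<in>fst (Gs j). u = v \<or> {u, v} \<in> snd (Gs j) \<longrightarrow> Q u v = conmat g j y u v)"
  let ?T = "pattern_words n g m dh Gs"
  define y' where "y' w = (if w \<in> ?T then y w else 0)" for w
  have "psd_on (words_upto n (dh - dj g j)) (conmat g j y')" if j: "j \<in> {0..m}" for j
  proof -
    let ?V = "words_upto n (dh - dj g j)"
    let ?F = "Fgraph n g m dh Gs j"
    let ?E = "{(a, b). {a, b} \<in> snd ?F}"
    define R where "R = {(u, v). u \<in> ?V \<and> v \<in> ?V \<and> (u, v) \<in> ?E\<^sup>*}"
    have fst_F: "fst ?F = ?V" by (simp add: Fgraph_def)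
    have V: "fst (Gs j) = ?V" using stable[OF j] fst_F by (simp add: max_chordal_ext_def)
    have "sym ?E" by (auto simp: sym_def insert_commute)
    then have symE: "(u, v) \<in> ?E\<^sup>* \<Longrightarrow> (v, u) \<in> ?E\<^sup>*" for u v
      using sym_rtrancl by (metis symD)
    have snd_G: "snd (Gs j) = {{u, v} | u v. u \<in> ?V \<and> v \<in> ?V \<and> u \<noteq> v \<and> (u, v) \<in> ?E\<^sup>*}"
      using stable[OF j] fst_F by (simp add: max_chordal_ext_def)
    \<comment> \<open>Because the iteration fixes the graph, its edges are all pairs within a
      component of \<open>?F\<close>; thus \<open>R\<close> is at once an equivalence and the
      pattern.\<close>
    have R_iff: "(u, v) \<in> R \<longleftrightarrow> u = v \<or> {u, v} \<in> snd (Gs j)" if "u \<in> ?V" "v \<in> ?V" for u v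
    proof -
      have "{u, v} \<in> snd (Gs j) \<longleftrightarrow> u \<noteq> v \<and> (u, v) \<in> ?E\<^sup>*"
        unfolding snd_G using that symE by (auto simp: doubleton_eq_iff)
      then show ?thesis using that unfolding R_def by auto
    qed
    have "equiv ?V R"
      unfolding R_def by (rule equivI) (auto simp: refl_on_def sym_def trans_def intro: symE rtrancl_trans)
    moreover obtain Q where Q: "psd_on ?V Q"
      "\<And>u v. u \<in> ?V \<Longrightarrow> v \<in> ?V \<Longrightarrow> u = v \<or> {u, v} \<in> snd (Gs j) \<Longrightarrow> Q u v = conmat g j y u v"
      using P j V by metis
    ultimately have "psd_on ?V (\<lambda>u v. if (u, v) \<in> R then Q u v else 0)"
      by (intro psd_on_block_diagonal) auto
    moreover have eq: "(if (u, v) \<in> R then Q u v else 0) = conmat g j y' u v"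
      if uv: "u \<in> ?V" "v \<in> ?V" for u v
    proof (cases "(u, v) \<in> R")
      case True
      then have edge: "u = v \<or> {u, v} \<in> snd (Gs j)" using R_iff uv by blast
      then have "rev u @ w @ v \<in> ?T" if "w \<in> supp (gpoly g j)" for w
        using that j uv V by (intro pattern_wordsI[of j]) auto
      then have "conmat g j y' u v = conmat g j y u v"
        unfolding conmat_gpoly y'_def by (intro sum.cong) auto
      then show ?thesis using True Q(2)[OF uv edge] by simp
    next
      case False
      \<comment> \<open>Words in different components are not joined in \<open>?F\<close>, so by its
        definition no word of this entry lies in \<open>?T\<close>, and \<open>y'\<close> makes the
        entry zero.\<close>
      then have "u \<noteq> v" "{u, v} \<notin> snd ?F"
        using uv unfolding R_def by auto
      then have "rev u @ w @ v \<notin> ?T" if "w \<in> supp (gpoly g j)" for w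
        using that uv unfolding Fgraph_def pattern_words_def by auto
      then have "conmat g j y' u v = 0"
        unfolding conmat_gpoly y'_def by (intro sum.neutral) auto
      then show ?thesis using False by simp
    qed
    ultimately show ?thesis
      using psd_on_cong[of ?V "\<lambda>u v. if (u, v) \<in> R then Q u v else 0" "conmat g j y'"] by blast
  qed
  moreover have "Lfun y f = Lfun y' f"
    unfolding Lfun_def y'_def using f by (intro sum.cong) auto
  moreover have "y' [] = 1"
    using y by (simp add: y'_def pattern_words_def)
  ultimately show "\<exists>y'. ereal (Lfun y f) = ereal (Lfun y' f) \<and> y' [] = 1 \<and>
      (\<forall>j\<in>{0..m}. psd_on (words_upto n (dh - dj g j)) (conmat g j y'))"
    by auto
qed

lemma max_chordal_ext_stable_value:
  assumes f: "is_ncpoly n f" and dh: "dh \<ge> dmin f g m"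
    and stable: "\<And>j. j \<in> {0..m} \<Longrightarrow>
      tsgraph max_chordal_ext n f g m dh (Suc k) j = tsgraph max_chordal_ext n f g m dh k j"
  shows "primal_val n f g m (tsgraph max_chordal_ext n f g m dh k) = dense_val n f g m dh"
proof (rule antisym)
  show "primal_val n f g m (tsgraph max_chordal_ext n f g m dh k) \<le> dense_val n f g m dh"
    using graph_wf_tsgraph(2)[OF monotone_ext_max_chordal_ext] by (rule primal_val_le_dense_val)
  show "dense_val n f g m dh \<le> primal_val n f g m (tsgraph max_chordal_ext n f g m dh k)"
    using stable supp_subset_pattern_words[OF monotone_ext_max_chordal_ext f dh]
    by (intro dense_val_le_stable_primal_val) auto
qed

lemma max_chordal_ext_reaches_dense_val:
  assumes f: "is_ncpoly n f" and dh: "dh \<ge> dmin f g m"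
  shows "\<exists>K\<ge>1. \<forall>k\<ge>K. lam_ts max_chordal_ext n f g m dh k = dense_val n f g m dh"
    and "lam_ts_circ max_chordal_ext n f g m dh = dense_val n f g m dh"
proof -
  let ?G = "tsgraph max_chordal_ext n f g m dh"
  let ?P = "\<lambda>K. \<forall>k\<ge>K. \<forall>j\<in>{0..m}. ?G k j = ?G K j"
  let ?K = "stab_index max_chordal_ext n f g m dh"
  have "\<exists>K. ?P K" by (rule tsgraph_stabilizes[OF monotone_ext_max_chordal_ext])
  then have stab: "?P ?K" unfolding stab_index_def by (rule LeastI_ex)
  have eq: "primal_val n f g m (?G k) = dense_val n f g m dh" if k: "k \<ge> ?K" for k
  proof (rule max_chordal_ext_stable_value[OF f dh])
    fix j assume "j \<in> {0..m}"
    then show "?G (Suc k) j = ?G k j" using stab k by (metis le_SucI)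
  qed
  then show "lam_ts_circ max_chordal_ext n f g m dh = dense_val n f g m dh"
    by (simp add: lam_ts_circ_def)
  show "\<exists>K\<ge>1. \<forall>k\<ge>K. lam_ts max_chordal_ext n f g m dh k = dense_val n f g m dh"
    \<comment> \<open>The successor ensures \<open>K \<ge> 1\<close>, since the stabilisation index
      may be 0.\<close>
    using eq by (intro exI[of _ "Suc ?K"]) (auto simp: lam_ts_def)
qed

section \<open>Duality\<close>

lemma sum_fun_apply: "(\<Sum>i\<in>I. F i) x = (\<Sum>i\<in>I. F i x)"
  by (induction I rule: infinite_finite_induct) (auto simp: zero_fun_def)

text \<open>One matrix for each constraint index. Entries outside the vertex sets are arbitrary and
  are absorbed by the null tuples defined below.\<close>

type_synonym blocks = "nat \<Rightarrow> word \<Rightarrow> word \<Rightarrow> real"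

definition unit_block :: "nat \<Rightarrow> word \<Rightarrow> word \<Rightarrow> blocks" where
  "unit_block j u v = (\<lambda>j' u' v'. if j' = j \<and> u' = u \<and> v' = v then 1 else 0)"

definition rank_one_block :: "nat \<Rightarrow> (word \<Rightarrow> real) \<Rightarrow> blocks" where
  "rank_one_block j x = (\<lambda>j' u v. if j' = j then x u * x v else 0)"

lemma psd_on_rank_one_block: "psd_on V (rank_one_block j x j')"
  unfolding psd_on_def
proof (intro conjI ballI allI)
  fix z
  have "(\<Sum>u\<in>V. \<Sum>v\<in>V. z u * rank_one_block j x j' u v * z v) =
      (if j' = j then (\<Sum>u\<in>V. z u * x u)\<^sup>2 else 0)"
    by (simp add: rank_one_block_def power2_eq_square sum_product algebra_simps)
  then show "0 \<le> (\<Sum>u\<in>V. \<Sum>v\<in>V. z u * rank_one_block j x j' u v * z v)" by simp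
qed (simp add: rank_one_block_def)

lemma rank_one_block_indicator:
  "unit_block j u u = rank_one_block j (\<lambda>w. if w = u then 1 else 0)"
  by (auto simp: unit_block_def rank_one_block_def fun_eq_iff)

text \<open>The free sign and size of \<open>s\<close> serve to bound off-diagonal units by diagonal
  ones.\<close>

lemma rank_one_block_two_points:
  "rank_one_block j (\<lambda>w. (if w = u then 1 else 0) + s * (if w = v then 1 else 0)) =
     unit_block j u u + s\<^sup>2 *\<^sub>R unit_block j v v + s *\<^sub>R unit_block j u v + s *\<^sub>R unit_block j v u"
  by (auto simp: unit_block_def rank_one_block_def fun_eq_iff power2_eq_square algebra_simps)

text \<open>The involution sends \<open>rev u @ a @ v\<close> to \<open>rev v @ rev a @ u\<close>,
  and a symmetric polynomial has equal coefficients at \<open>a\<close> and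
  \<open>rev a\<close>.\<close>

lemma Dmat_rev:
  assumes "is_sym (gpoly g j)"
  shows "Dmat g j (rev w) u v = Dmat g j w v u"
  unfolding Dmat_def
proof (rule sum.reindex_bij_witness[of _ rev rev])
  fix a assume "a \<in> supp (gpoly g j)"
  then show "rev a \<in> supp (gpoly g j)"
    using assms by (simp add: supp_def is_sym_def)
  have "rev (rev v @ rev a @ u) = rev u @ a @ v" by simp
  then have "rev v @ rev a @ u = w \<longleftrightarrow> rev u @ a @ v = rev w"
    by (metis rev_rev_ident)
  then show "(if rev v @ rev a @ u = w then gpoly g j (rev a) else 0) =
      (if rev u @ a @ v = rev w then gpoly g j a else 0)"
    using assms by (simp add: is_sym_def)
qed (use assms in \<open>auto simp: supp_def is_sym_def\<close>)

lemma Dmat_0: "Dmat g 0 w a b = (if rev a @ b = w then 1 else 0)"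
  by (simp add: Dmat_def) (simp add: ncone_def)

lemma conmat_transpose:
  assumes "is_sym (gpoly g j)"
  shows "conmat g j y v u = conmat g j (\<lambda>w. y (rev w)) u v"
  unfolding conmat_gpoly
  by (rule sum.reindex_bij_witness[of _ rev rev]) (use assms in \<open>auto simp: supp_def is_sym_def\<close>)

lemma supp_ball_poly: "R > 0 \<Longrightarrow> supp (ball_poly n R) = insert [] {[i, i] | i. i < n}"
  by (auto simp: supp_def ball_poly_def)

lemma deg_ball_poly:
  assumes "R > 0" "n \<ge> 1"
  shows "deg (ball_poly n R) = 2"
proof -
  have "length ` supp (ball_poly n R) = {0, 2}"
    using assms by (auto simp: supp_ball_poly intro!: image_eqI[of 2 length "[0, 0]"])
  then show ?thesis by (simp add: deg_def)
qed

text \<open>The properties of the graphs behind duality, detached from the iteration. By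
  \<open>diagonal_word_edge\<close>, a diagonal localizing entry can be rewritten in the moment
  block, with any factorisation of its words, without leaving the pattern.\<close>

locale sparsity_pattern =
  fixes n m dh :: nat and g :: "nat \<Rightarrow> ncpoly" and Gs :: "nat \<Rightarrow> wgraph"
  assumes gpoly_ncpoly: "j \<in> {0..m} \<Longrightarrow> is_ncpoly n (gpoly g j)"
    and gpoly_sym: "j \<in> {0..m} \<Longrightarrow> is_sym (gpoly g j)"
    and wf: "j \<in> {0..m} \<Longrightarrow> graph_wf (Gs j)"
    and verts: "j \<in> {0..m} \<Longrightarrow> fst (Gs j) = words_upto n (dh - dj g j)"
    and dj_le: "j \<in> {0..m} \<Longrightarrow> dj g j \<le> dh"
    and diagonal_word_edge: "\<lbrakk>j \<in> {0..m}; u \<in> fst (Gs j); w \<in> supp (gpoly g j); rev a @ b = rev u @ w @ u;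
        a \<in> words_upto n dh; b \<in> words_upto n dh; a \<noteq> b\<rbrakk> \<Longrightarrow> {a, b} \<in> snd (Gs 0)"
begin

abbreviation V :: "nat \<Rightarrow> word set" where "V j \<equiv> fst (Gs j)"

abbreviation T :: "word set" where "T \<equiv> pattern_words n g m dh Gs"

definition adj :: "nat \<Rightarrow> word \<Rightarrow> word \<Rightarrow> bool" where
  "adj j u v \<longleftrightarrow> u = v \<or> {u, v} \<in> snd (Gs j)"

text \<open>Left-hand side of the dual constraint at \<open>w\<close> without its \<open>lam\<close>
  term.\<close>

definition coef :: "word \<Rightarrow> blocks \<Rightarrow> real" where
  "coef w M = (\<Sum>j=0..m. \<Sum>u\<in>V j. \<Sum>v\<in>V j. M j u v * Dmat g j w u v)"

text \<open>Matrices need not be symmetric here: the constraints are symmetrised instead, so that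
  antisymmetric matrices are null.\<close>

definition null_block :: "blocks \<Rightarrow> bool" where
  "null_block M \<longleftrightarrow> (\<forall>w\<in>T. coef w M + coef (rev w) M = 0) \<and>
     (\<forall>j\<in>{0..m}. \<forall>u\<in>V j. \<forall>v\<in>V j. \<not> adj j u v \<longrightarrow> M j u v + M j v u = 0)"

definition psd_mod_null :: "blocks set" where
  "psd_mod_null = {M. \<exists>Q. (\<forall>j\<in>{0..m}. psd_on (V j) (Q j)) \<and> null_block (Q - M)}"

lemma adj_refl [simp]: "adj j u u"
  and adj_commute: "adj j u v \<longleftrightarrow> adj j v u"
  by (auto simp: adj_def insert_commute)

lemma finite_V [simp]: "j \<in> {0..m} \<Longrightarrow> finite (V j)"
  using wf unfolding graph_wf_def by blast

lemma V_0 [simp]: "V 0 = words_upto n dh"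
  using verts[of 0] by simp

lemma finite_T [simp]: "finite T"
proof -
  have "finite (gsupp (gpoly g j) (Gs j))" if j: "j \<in> {0..m}" for j
  proof (rule finite_subset)
    show "gsupp (gpoly g j) (Gs j) \<subseteq>
        (\<lambda>(u, w, v). rev u @ w @ v) ` (V j \<times> supp (gpoly g j) \<times> V j)"
    proof
      fix z assume "z \<in> gsupp (gpoly g j) (Gs j)"
      then obtain u w v where z: "z = rev u @ w @ v" "w \<in> supp (gpoly g j)"
        "u = v \<and> u \<in> V j \<or> {u, v} \<in> snd (Gs j)"
        unfolding gsupp_def by blast
      have "u \<in> V j \<and> v \<in> V j"
        using z(3) wf[OF j] unfolding graph_wf_def by (metis doubleton_eq_iff)
      then show "z \<in> (\<lambda>(u, w, v). rev u @ w @ v) ` (V j \<times> supp (gpoly g j) \<times> V j)"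
        using z by force
    qed
    show "finite ((\<lambda>(u, w, v). rev u @ w @ v) ` (V j \<times> supp (gpoly g j) \<times> V j))"
      using gpoly_ncpoly[OF j] j by (simp add: is_ncpoly_def)
  qed
  moreover have "finite (sq_words n dh)"
  proof -
    have "sq_words n dh = (\<lambda>u. rev u @ u) ` words_upto n dh" by (auto simp: sq_words_def)
    then show ?thesis by simp
  qed
  ultimately show ?thesis unfolding pattern_words_def by auto
qed

lemma Nil_in_T [simp]: "[] \<in> T"
  by (simp add: pattern_words_def)

lemma linear_coef: "linear (coef w)"
  by (rule linearI) (auto simp: coef_def sum.distrib sum_distrib_left algebra_simps)

lemmas coef_add = linear_add[OF linear_coef]
  and coef_diff = linear_diff[OF linear_coef]
  and coef_scale = linear_scale[OF linear_coef]
  and coef_sum = linear_sum[OF linear_coef]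

lemma coef_unit_block:
  assumes "j \<in> {0..m}" "u \<in> V j" "v \<in> V j"
  shows "coef w (unit_block j u v) = Dmat g j w u v"
proof -
  have block: "(\<Sum>u'\<in>V j. \<Sum>v'\<in>V j. unit_block j u v j u' v' * Dmat g j w u' v') = Dmat g j w u v"
  proof -
    have "(\<Sum>v'\<in>V j. unit_block j u v j u' v' * Dmat g j w u' v') =
        (\<Sum>v'\<in>V j. if v' = v then (if u' = u then Dmat g j w u v else 0) else 0)" for u'
      by (intro sum.cong refl) (auto simp: unit_block_def)
    then show ?thesis using assms by simp
  qed
  have "coef w (unit_block j u v) = (\<Sum>j'=0..m. if j' = j then
      (\<Sum>u'\<in>V j. \<Sum>v'\<in>V j. unit_block j u v j u' v' * Dmat g j w u' v') else 0)"
    unfolding coef_def by (intro sum.cong refl) (auto simp: unit_block_def)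
  then show ?thesis using assms block by simp
qed

text \<open>Reversing \<open>w\<close> amounts to swapping the two summations. Hence on symmetric
  tuples the symmetrised constraints say the same as the original ones.\<close>

lemma coef_rev_symmetric:
  assumes "\<And>j u v. j \<in> {0..m} \<Longrightarrow> u \<in> V j \<Longrightarrow> v \<in> V j \<Longrightarrow> M j u v = M j v u"
  shows "coef (rev w) M = coef w M"
proof -
  have "coef (rev w) M = (\<Sum>j=0..m. \<Sum>u\<in>V j. \<Sum>v\<in>V j. M j v u * Dmat g j w v u)"
    unfolding coef_def using assms Dmat_rev[OF gpoly_sym] by (intro sum.cong refl) auto
  also have "\<dots> = coef w M"
    unfolding coef_def by (intro sum.cong refl sum.swap)
  finally show ?thesis .
qed

lemma coef_pairing:
  "(\<Sum>w\<in>T. y w * coef w M) =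
     (\<Sum>j=0..m. \<Sum>u\<in>V j. \<Sum>v\<in>V j. M j u v * (\<Sum>w\<in>T. y w * Dmat g j w u v))"
proof -
  have "(\<Sum>w\<in>T. y w * coef w M) =
      (\<Sum>w\<in>T. \<Sum>j=0..m. \<Sum>u\<in>V j. \<Sum>v\<in>V j. M j u v * (y w * Dmat g j w u v))"
    by (simp add: coef_def sum_distrib_left mult_ac)
  also have "\<dots> = (\<Sum>j=0..m. \<Sum>w\<in>T. \<Sum>u\<in>V j. \<Sum>v\<in>V j. M j u v * (y w * Dmat g j w u v))"
    by (rule sum.swap)
  also have "\<dots> = (\<Sum>j=0..m. \<Sum>u\<in>V j. \<Sum>w\<in>T. \<Sum>v\<in>V j. M j u v * (y w * Dmat g j w u v))"
    by (intro sum.cong refl sum.swap)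
  also have "\<dots> = (\<Sum>j=0..m. \<Sum>u\<in>V j. \<Sum>v\<in>V j. \<Sum>w\<in>T. M j u v * (y w * Dmat g j w u v))"
    by (intro sum.cong refl sum.swap)
  finally show ?thesis by (simp add: sum_distrib_left)
qed

text \<open>All words of an entry on the pattern lie in \<open>T\<close>, so summing over
  \<open>T\<close> loses no term.\<close>

lemma pattern_sum_Dmat:
  assumes "j \<in> {0..m}" "u \<in> V j" "adj j u v"
  shows "(\<Sum>w\<in>T. y w * Dmat g j w u v) = conmat g j y u v"
proof -
  have "(\<Sum>w\<in>T. y w * Dmat g j w u v) =
      (\<Sum>w\<in>T. \<Sum>w'\<in>supp (gpoly g j). if w = rev u @ w' @ v then gpoly g j w' * y w else 0)"
    unfolding Dmat_def sum_distrib_left by (intro sum.cong refl) auto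
  also have "\<dots> = (\<Sum>w'\<in>supp (gpoly g j). \<Sum>w\<in>T. if w = rev u @ w' @ v then gpoly g j w' * y w else 0)"
    by (rule sum.swap)
  also have "\<dots> = conmat g j y u v"
    unfolding conmat_gpoly
  proof (rule sum.cong[OF refl])
    fix w' assume "w' \<in> supp (gpoly g j)"
    then have "rev u @ w' @ v \<in> T"
      using assms by (intro pattern_wordsI[of j]) (auto simp: adj_def)
    then show "(\<Sum>w\<in>T. if w = rev u @ w' @ v then gpoly g j w' * y w else 0) =
        gpoly g j w' * y (rev u @ w' @ v)" by simp
  qed
  finally show ?thesis .
qed

lemma Lfun_pattern:
  assumes "supp f \<subseteq> T"
  shows "Lfun y f = (\<Sum>w\<in>T. f w * y w)"
  unfolding Lfun_def using assms by (intro sum.mono_neutral_left) (auto simp: supp_def)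

text \<open>Pairing the dual constraints with \<open>y\<close> expresses \<open>L_y(f) - lam\<close>
  as the inner product of \<open>Q\<close> with the moment and localizing matrices. As
  \<open>Q\<close> vanishes off the pattern, these may be replaced by their psd completions.\<close>

lemma weak_duality:
  assumes f: "supp f \<subseteq> T"
  shows "dual_val n f g m dh Gs \<le> primal_val n f g m Gs"
  unfolding dual_val_def primal_val_def
proof (intro Sup_least Inf_greatest, clarify)
  fix lam y Q
  assume y: "y [] = 1" and P: "\<forall>j\<in>{0..m}. \<exists>Q. psd_on (V j) Q \<and>
      (\<forall>u\<in>V j. \<forall>v\<in>V j. u = v \<or> {u, v} \<in> snd (Gs j) \<longrightarrow> Q u v = conmat g j y u v)"
    and Q: "\<forall>j\<in>{0..m}. psd_on (V j) (Q j) \<and>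
      (\<forall>u\<in>V j. \<forall>v\<in>V j. u \<noteq> v \<and> {u, v} \<notin> snd (Gs j) \<longrightarrow> Q j u v = 0)"
    and eq: "\<forall>w\<in>(\<Union>j\<in>{0..m}. gsupp (gpoly g j) (Gs j)) \<union> sq_words n dh.
      (\<Sum>j=0..m. \<Sum>u\<in>V j. \<Sum>v\<in>V j. Q j u v * Dmat g j w u v) + lam * (if w = [] then 1 else 0) = f w"
  obtain P where P: "\<And>j. j \<in> {0..m} \<Longrightarrow> psd_on (V j) (P j)"
    "\<And>j u v. j \<in> {0..m} \<Longrightarrow> u \<in> V j \<Longrightarrow> v \<in> V j \<Longrightarrow> adj j u v \<Longrightarrow> P j u v = conmat g j y u v"
    using P unfolding adj_def by metis
  have fw: "f w = coef w Q + lam * (if w = [] then 1 else 0)" if "w \<in> T" for w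
    using eq that unfolding pattern_words_def coef_def by simp
  have "Lfun y f = (\<Sum>w\<in>T. y w * coef w Q + (if w = [] then lam * y w else 0))"
    unfolding Lfun_pattern[OF f] using fw by (intro sum.cong) (auto simp: algebra_simps)
  also have "\<dots> = (\<Sum>w\<in>T. y w * coef w Q) + lam"
    using y by (simp add: sum.distrib)
  also have "(\<Sum>w\<in>T. y w * coef w Q) = (\<Sum>j=0..m. \<Sum>u\<in>V j. \<Sum>v\<in>V j. Q j u v * P j u v)"
    unfolding coef_pairing
  proof (intro sum.cong refl)
    fix j u v assume juv: "j \<in> {0..m}" "u \<in> V j" "v \<in> V j"
    show "Q j u v * (\<Sum>w\<in>T. y w * Dmat g j w u v) = Q j u v * P j u v"
    proof (cases "adj j u v")
      case True
      then show ?thesis using pattern_sum_Dmat[OF juv(1,2) True] P(2)[OF juv True] by simp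
    next
      case False
      then show ?thesis using Q juv unfolding adj_def by simp
    qed
  qed
  finally have L: "Lfun y f = (\<Sum>j=0..m. \<Sum>u\<in>V j. \<Sum>v\<in>V j. Q j u v * P j u v) + lam" .
  have "0 \<le> (\<Sum>j=0..m. \<Sum>u\<in>V j. \<Sum>v\<in>V j. Q j u v * P j u v)"
    using P(1) Q by (intro sum_nonneg psd_on_inner_product_nonneg) auto
  then show "ereal lam \<le> ereal (Lfun y f)" using L by simp
qed

section \<open>Positive semidefinite tuples modulo null tuples\<close>

lemma null_block_linear:
  assumes "null_block M" "null_block N"
  shows "null_block (M + N)" "null_block (t *\<^sub>R M)"
proof -
  have "coef w (M + N) + coef (rev w) (M + N) = 0" if "w \<in> T" for w
    using assms that unfolding null_block_def coef_add by (smt (verit))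
  moreover have "(M + N) j u v + (M + N) j v u = 0"
    if "j \<in> {0..m}" "u \<in> V j" "v \<in> V j" "\<not> adj j u v" for j u v
    using assms that unfolding null_block_def by (simp add: algebra_simps)
  ultimately show "null_block (M + N)" unfolding null_block_def by blast
  have "coef w (t *\<^sub>R M) + coef (rev w) (t *\<^sub>R M) = 0" if "w \<in> T" for w
    using assms that unfolding null_block_def coef_scale by (metis scaleR_right_distrib scaleR_zero_right)
  moreover have "(t *\<^sub>R M) j u v + (t *\<^sub>R M) j v u = 0"
    if "j \<in> {0..m}" "u \<in> V j" "v \<in> V j" "\<not> adj j u v" for j u v
    using assms that unfolding null_block_def by (simp add: distrib_left[symmetric])
  ultimately show "null_block (t *\<^sub>R M)" unfolding null_block_def by blast
qed

lemma null_block_zero_entries: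
  assumes "\<And>j u v. j \<in> {0..m} \<Longrightarrow> u \<in> V j \<Longrightarrow> v \<in> V j \<Longrightarrow> M j u v = 0"
  shows "null_block M"
  unfolding null_block_def coef_def using assms by simp

lemma null_block_0: "null_block 0"
  by (rule null_block_zero_entries) simp

lemma null_block_minus: "null_block M \<Longrightarrow> null_block (- M)"
  using null_block_linear(2)[of M M "-1"] by simp

lemma psd_in_psd_mod_null:
  "(\<And>j. j \<in> {0..m} \<Longrightarrow> psd_on (V j) (M j)) \<Longrightarrow> M \<in> psd_mod_null"
  unfolding psd_mod_null_def using null_block_0 by (auto intro!: exI[of _ M])

lemma null_in_psd_mod_null:
  assumes "null_block M"
  shows "M \<in> psd_mod_null"
proof -
  have "psd_on (V j) ((0::blocks) j)" for j
    by (simp add: psd_on_def)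
  moreover have "null_block (0 - M)" using null_block_minus[OF assms] by simp
  ultimately show ?thesis unfolding psd_mod_null_def by blast
qed

lemma is_cone_psd_mod_null: "is_cone psd_mod_null"
  unfolding is_cone_def
proof (intro conjI ballI allI impI)
  show "0 \<in> psd_mod_null" by (rule null_in_psd_mod_null[OF null_block_0])
  fix M assume "M \<in> psd_mod_null"
  then obtain P where P: "\<forall>j\<in>{0..m}. psd_on (V j) (P j)" "null_block (P - M)"
    unfolding psd_mod_null_def by blast
  show "t *\<^sub>R M \<in> psd_mod_null" if t: "t \<ge> 0" for t
  proof -
    have "null_block (t *\<^sub>R P - t *\<^sub>R M)"
      using null_block_linear(2)[OF P(2) P(2), of t] by (simp add: scaleR_diff_right)
    moreover have "\<forall>j\<in>{0..m}. psd_on (V j) ((t *\<^sub>R P) j)"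
      using P(1) t psd_on_scaleR unfolding scaleR_fun_apply by blast
    ultimately show ?thesis unfolding psd_mod_null_def by blast
  qed
  fix N assume "N \<in> psd_mod_null"
  then obtain Q where Q: "\<forall>j\<in>{0..m}. psd_on (V j) (Q j)" "null_block (Q - N)"
    unfolding psd_mod_null_def by blast
  have "null_block ((P + Q) - (M + N))"
    using null_block_linear(1)[OF P(2) Q(2)] by (simp add: add_diff_add)
  moreover have "\<forall>j\<in>{0..m}. psd_on (V j) ((P + Q) j)"
    using P(1) Q(1) psd_on_add unfolding plus_fun_apply by blast
  ultimately show "M + N \<in> psd_mod_null" unfolding psd_mod_null_def by blast
qed

lemma rank_one_in_psd_mod_null: "rank_one_block j x \<in> psd_mod_null"
  by (rule psd_in_psd_mod_null) (rule psd_on_rank_one_block)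

text \<open>Transposing a unit exchanges its coefficients at \<open>w\<close> and
  \<open>rev w\<close>, so the symmetrised sums cancel.\<close>

lemma null_block_antisym:
  assumes "j \<in> {0..m}" "u \<in> V j" "v \<in> V j"
  shows "null_block (unit_block j u v - unit_block j v u)"
proof -
  have "coef (rev w) (unit_block j u v) = coef w (unit_block j v u)"
    if "u \<in> V j" "v \<in> V j" for w u v
    using that assms(1) by (simp add: coef_unit_block Dmat_rev[OF gpoly_sym[OF assms(1)]])
  then have "coef w (unit_block j u v - unit_block j v u) +
      coef (rev w) (unit_block j u v - unit_block j v u) = 0" for w
    using assms unfolding coef_diff by simp
  moreover have "(unit_block j u v - unit_block j v u) j' a b +
      (unit_block j u v - unit_block j v u) j' b a = 0" for j' a b
  proof -
    have "unit_block j u v j' a b = unit_block j v u j' b a" for u v a b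
      by (simp add: unit_block_def conj_commute)
    from this[of u v a b] this[of u v b a] show ?thesis by simp
  qed
  ultimately show ?thesis unfolding null_block_def by blast
qed

lemma unit_block_nonadj:
  assumes "adj j a b" "\<not> adj j' u v"
  shows "unit_block j a b j' u v = 0" "unit_block j a b j' v u = 0"
  using assms adj_commute unfolding unit_block_def by auto

text \<open>The diagonal entry of block \<open>j\<close> at \<open>u\<close> stands for
  \<open>u^* g_j u\<close>, whose words are moved to the moment entries \<open>(a w, b w)\<close>.
  Both sides have the same coefficients and live on the pattern.\<close>

lemma null_block_diagonal_expansion:
  assumes j: "j \<in> {0..m}" and u: "u \<in> V j"
    and ab: "\<And>w. w \<in> supp (gpoly g j) \<Longrightarrow>
      a w \<in> words_upto n dh \<and> b w \<in> words_upto n dh \<and> rev (a w) @ b w = rev u @ w @ u"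
  shows "null_block (unit_block j u u - (\<Sum>w\<in>supp (gpoly g j). gpoly g j w *\<^sub>R unit_block 0 (a w) (b w)))"
    (is "null_block (_ - ?S)")
proof -
  have adj: "adj 0 (a w) (b w)" if "w \<in> supp (gpoly g j)" for w
    using diagonal_word_edge[OF j u that, of "a w" "b w"] ab[OF that] by (auto simp: adj_def)
  have "coef z ?S = Dmat g j z u u" for z
    unfolding coef_sum coef_scale Dmat_def
  proof (rule sum.cong[OF refl])
    fix w assume w: "w \<in> supp (gpoly g j)"
    show "gpoly g j w *\<^sub>R coef z (unit_block 0 (a w) (b w)) =
        (if rev u @ w @ u = z then gpoly g j w else 0)"
      using ab[OF w] by (simp add: coef_unit_block Dmat_0)
  qed
  then have "coef z (unit_block j u u - ?S) = 0" for z
    using j u by (simp add: coef_diff coef_unit_block)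
  moreover have "(unit_block j u u - ?S) j' u' v' = 0 \<and> (unit_block j u u - ?S) j' v' u' = 0"
    if "\<not> adj j' u' v'" for j' u' v'
    using that adj by (simp add: sum_fun_apply unit_block_nonadj)
  ultimately show ?thesis unfolding null_block_def by simp
qed

text \<open>The tuples bounded below by a negative multiple of the unit at the empty word; the order
  unit property says that these are all tuples.\<close>

definition dominated :: "blocks set" where
  "dominated = {M. \<exists>t\<ge>0. t *\<^sub>R unit_block 0 [] [] + M \<in> psd_mod_null}"

lemma is_cone_dominated: "is_cone dominated"
  unfolding is_cone_def
proof (intro conjI ballI allI impI)
  note W = is_cone_psd_mod_null
  let ?E = "unit_block 0 [] []"
  have "0 *\<^sub>R ?E + 0 \<in> psd_mod_null" using is_cone_0[OF W] by simp
  then show "0 \<in> dominated" unfolding dominated_def by blast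
  fix M assume "M \<in> dominated"
  then obtain s where s: "s \<ge> 0" "s *\<^sub>R ?E + M \<in> psd_mod_null" unfolding dominated_def by blast
  show "t *\<^sub>R M \<in> dominated" if t: "t \<ge> 0" for t
  proof -
    have "(t * s) *\<^sub>R ?E + t *\<^sub>R M \<in> psd_mod_null"
      using is_cone_scaleR[OF W s(2) t] by (simp add: scaleR_add_right)
    then show ?thesis unfolding dominated_def using s t by (auto intro!: exI[of _ "t * s"])
  qed
  fix N assume "N \<in> dominated"
  then obtain t where t: "t \<ge> 0" "t *\<^sub>R ?E + N \<in> psd_mod_null" unfolding dominated_def by blast
  have "(s + t) *\<^sub>R ?E + (M + N) \<in> psd_mod_null"
    using is_cone_add[OF W s(2) t(2)] by (simp add: algebra_simps)
  then show "M + N \<in> dominated" unfolding dominated_def using s t by (auto intro!: exI[of _ "s + t"])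
qed

lemma psd_mod_null_subset_dominated: "psd_mod_null \<subseteq> dominated"
proof
  fix M assume "M \<in> psd_mod_null"
  then have "0 *\<^sub>R unit_block 0 [] [] + M \<in> psd_mod_null" by simp
  then show "M \<in> dominated" unfolding dominated_def by blast
qed

lemma unit_block_diag_in_dominated: "unit_block j u u \<in> dominated"
  unfolding rank_one_block_indicator
  using rank_one_in_psd_mod_null psd_mod_null_subset_dominated by blast

text \<open>Removing the diagonal terms from \<open>(e_u + s e_v)(e_u + s e_v)^T\<close> leaves
  \<open>s (E_uv + E_vu)\<close>, and adding the null tuple \<open>s (E_uv - E_vu)\<close> gives
  \<open>2 s E_uv\<close>; hence \<open>s = c / 2\<close>.\<close>

lemma unit_block_dominated:
  assumes "j \<in> {0..m}" "u \<in> V j" "v \<in> V j"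
    and "- unit_block j u u \<in> dominated" "- unit_block j v v \<in> dominated"
  shows "c *\<^sub>R unit_block j u v \<in> dominated"
proof -
  define s where "s = c / 2"
  let ?x = "\<lambda>w. (if w = u then 1 else 0) + s * (if w = v then 1 else 0)"
  have "null_block (s *\<^sub>R (unit_block j u v - unit_block j v u))"
    using null_block_linear(2) null_block_antisym[OF assms(1-3)] by blast
  then have "s *\<^sub>R (unit_block j u v - unit_block j v u) \<in> dominated"
    using null_in_psd_mod_null psd_mod_null_subset_dominated by blast
  moreover have "rank_one_block j ?x \<in> dominated"
    using rank_one_in_psd_mod_null psd_mod_null_subset_dominated by blast
  moreover have "s\<^sup>2 *\<^sub>R (- unit_block j v v) \<in> dominated"
    using is_cone_scaleR[OF is_cone_dominated assms(5), of "s\<^sup>2"] by simp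
  ultimately have "rank_one_block j ?x + s *\<^sub>R (unit_block j u v - unit_block j v u) +
      (- unit_block j u u) + s\<^sup>2 *\<^sub>R (- unit_block j v v) \<in> dominated"
    using assms(4) by (intro is_cone_add[OF is_cone_dominated])
  also have "rank_one_block j ?x + s *\<^sub>R (unit_block j u v - unit_block j v u) +
      (- unit_block j u u) + s\<^sup>2 *\<^sub>R (- unit_block j v v) = s *\<^sub>R unit_block j u v + s *\<^sub>R unit_block j u v"
    unfolding rank_one_block_two_points by (simp add: algebra_simps)
  finally show ?thesis by (simp only: s_def scaleR_left_distrib[symmetric] field_sum_of_halves)
qed

text \<open>Induction on the word. Modulo null tuples the unit of the ball block at \<open>u\<close>
  equals \<open>R^2 E_(u,u)\<close> minus the sum of the \<open>E_(ku,ku)\<close> over all letters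
  \<open>k\<close>, so \<open>- E_(iu,iu)\<close> is \<open>- R^2 E_(u,u)\<close> plus psd diagonal
  units.\<close>

lemma dominated_moment_diag:
  assumes n: "n \<ge> 1" and m: "m \<ge> 1" and R: "R > 0" and ball: "g 1 = ball_poly n R"
    and "u \<in> words_upto n dh"
  shows "- unit_block 0 u u \<in> dominated"
  using assms(5)
proof (induction u)
  case Nil
  have "1 *\<^sub>R unit_block 0 [] [] + - unit_block 0 [] [] \<in> psd_mod_null"
    using is_cone_0[OF is_cone_psd_mod_null] by simp
  moreover have "(1::real) \<ge> 0" by simp
  ultimately show ?case unfolding dominated_def by blast
next
  case (Cons i u)
  note cone = is_cone_dominated
  let ?p = "ball_poly n R"
  let ?S = "supp ?p"
  have g1: "gpoly g 1 = ?p" using ball by (simp add: gpoly_def)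
  \<comment> \<open>The ball polynomial has half-degree 1, so words shorter than \<open>dh\<close>
    index its localizing matrix.\<close>
  have "dj g 1 = 1" using deg_ball_poly[OF R n] g1 by (simp add: dj_def)
  moreover have m1: "1 \<in> {0..m}" using m by simp
  ultimately have "V 1 = words_upto n (dh - 1)" using verts by simp
  moreover have i: "i < n" and u: "u \<in> words_upto n (dh - 1)" and dh: "dh \<ge> 1"
    using Cons.prems by (auto simp: words_upto_def)
  ultimately have uV: "u \<in> V 1" by simp
  have IH: "- unit_block 0 u u \<in> dominated"
    using Cons.IH u words_upto_mono[of "dh - 1" dh n] by (meson diff_le_self subsetD)
  \<comment> \<open>\<open>take 1\<close> fixes the empty word and sends \<open>[k, k]\<close> to
    \<open>[k]\<close>, so \<open>rev u @ w @ u\<close> becomes the diagonal moment entry at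
    \<open>t w\<close>.\<close>
  define t where "t w = take 1 w @ u" for w :: word
  have "t w \<in> words_upto n dh \<and> rev (t w) @ t w = rev u @ w @ u" if "w \<in> ?S" for w
    using that u dh Cons.prems by (auto simp: supp_ball_poly[OF R] t_def words_upto_def)
  then have "null_block (unit_block 1 u u - (\<Sum>w\<in>?S. ?p w *\<^sub>R unit_block 0 (t w) (t w)))"
    using null_block_diagonal_expansion[OF m1 uV, of t t] unfolding g1 by blast
  then have "- (unit_block 1 u u - (\<Sum>w\<in>?S. ?p w *\<^sub>R unit_block 0 (t w) (t w))) \<in> dominated"
    using null_block_minus null_in_psd_mod_null psd_mod_null_subset_dominated by blast
  then have null: "(\<Sum>w\<in>?S. ?p w *\<^sub>R unit_block 0 (t w) (t w)) - unit_block 1 u u \<in> dominated"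
    unfolding minus_diff_eq .
  have iS: "[i, i] \<in> ?S" using i by (auto simp: supp_ball_poly[OF R])
  have fin: "finite ?S" using gpoly_ncpoly[OF m1] unfolding g1 is_ncpoly_def by blast
  have rest: "- (?p w *\<^sub>R unit_block 0 (t w) (t w)) \<in> dominated" if "w \<in> ?S" for w
  proof (cases "w = []")
    case True
    then show ?thesis
      using is_cone_scaleR[OF cone IH, of "R\<^sup>2"] by (simp add: t_def ball_poly_def)
  next
    case False
    then have "?p w = -1" using that by (auto simp: supp_def ball_poly_def split: if_splits)
    then show ?thesis using unit_block_diag_in_dominated by simp
  qed
  \<comment> \<open>Cancelling the localizing unit and all terms except that of
    \<open>[i, i]\<close> leaves the wanted unit with coefficient -1.\<close>
  have "((\<Sum>w\<in>?S. ?p w *\<^sub>R unit_block 0 (t w) (t w)) - unit_block 1 u u) + unit_block 1 u u +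
      (\<Sum>w\<in>?S - {[i, i]}. - (?p w *\<^sub>R unit_block 0 (t w) (t w))) \<in> dominated"
    using null rest
    by (intro is_cone_add[OF cone] is_cone_sum[OF cone] unit_block_diag_in_dominated) auto
  moreover have "(\<Sum>w\<in>?S. ?p w *\<^sub>R unit_block 0 (t w) (t w)) =
      ?p [i, i] *\<^sub>R unit_block 0 (t [i, i]) (t [i, i]) +
      (\<Sum>w\<in>?S - {[i, i]}. ?p w *\<^sub>R unit_block 0 (t w) (t w))"
    using fin iS by (rule sum.remove)
  moreover have "?p [i, i] = -1" "t [i, i] = i # u"
    using i by (auto simp: ball_poly_def t_def)
  ultimately have "- unit_block 0 (i # u) (i # u) \<in> dominated" by (simp add: sum_negf)
  then show ?case .
qed

text \<open>Domination spreads from the diagonal to all moment units, then through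
  \<open>null_block_diagonal_expansion\<close> to the diagonals of the other blocks, and so to all
  units. These span every tuple up to entries outside the vertex sets.\<close>

lemma dominated_UNIV:
  assumes n: "n \<ge> 1" and m: "m \<ge> 1" and R: "R > 0" and ball: "g 1 = ball_poly n R"
  shows "M \<in> dominated"
proof -
  note cone = is_cone_dominated
  have zero: "0 \<in> {0..m}" by simp
  have moment: "c *\<^sub>R unit_block 0 a b \<in> dominated"
    if "a \<in> words_upto n dh" "b \<in> words_upto n dh" for a b c
    using that unit_block_dominated[OF zero] dominated_moment_diag[OF n m R ball] by simp
  have diag: "- unit_block j u u \<in> dominated" if j: "j \<in> {0..m}" and u: "u \<in> V j" for j u
  proof -
    have "\<exists>a b. a \<in> words_upto n dh \<and> b \<in> words_upto n dh \<and> rev a @ b = rev u @ w @ u"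
      if w: "w \<in> supp (gpoly g j)" for w
    proof -
      \<comment> \<open>At most \<open>2 * dj g j\<close> letters from \<open>w\<close> and twice
        \<open>dh - dj g j\<close> from the two copies of \<open>u\<close> fit into
        \<open>2 * dh\<close>.\<close>
      have "length w \<le> 2 * dj g j"
        using length_le_deg[OF gpoly_ncpoly[OF j] w] unfolding dj_def by linarith
      moreover have "length u \<le> dh - dj g j" "set u \<subseteq> {..<n}"
        using u verts[OF j] by (auto simp: words_upto_def)
      moreover have "set w \<subseteq> {..<n}" using gpoly_ncpoly[OF j] w unfolding is_ncpoly_def by blast
      ultimately have "length (rev u @ w @ u) \<le> 2 * dh" "set (rev u @ w @ u) \<subseteq> {..<n}"
        using dj_le[OF j] by auto
      then show ?thesis by (rule words_upto_split) metis
    qed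
    then obtain a b where ab: "\<And>w. w \<in> supp (gpoly g j) \<Longrightarrow>
        a w \<in> words_upto n dh \<and> b w \<in> words_upto n dh \<and> rev (a w) @ b w = rev u @ w @ u"
      by metis
    let ?S = "\<Sum>w\<in>supp (gpoly g j). gpoly g j w *\<^sub>R unit_block 0 (a w) (b w)"
    have "- (unit_block j u u - ?S) \<in> dominated"
      using null_block_diagonal_expansion[OF j u ab] null_block_minus null_in_psd_mod_null
        psd_mod_null_subset_dominated by blast
    moreover have "(\<Sum>w\<in>supp (gpoly g j). (- gpoly g j w) *\<^sub>R unit_block 0 (a w) (b w)) \<in> dominated"
      using ab moment by (intro is_cone_sum[OF cone]) blast
    ultimately have "- (unit_block j u u - ?S) +
        (\<Sum>w\<in>supp (gpoly g j). (- gpoly g j w) *\<^sub>R unit_block 0 (a w) (b w)) \<in> dominated"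
      by (rule is_cone_add[OF cone])
    then show ?thesis by (simp add: sum_negf)
  qed
  let ?I = "SIGMA j:{0..m}. V j \<times> V j"
  let ?N = "\<Sum>(j, u, v)\<in>?I. M j u v *\<^sub>R unit_block j u v"
  have "(M - ?N) j u v = 0" if juv: "j \<in> {0..m}" "u \<in> V j" "v \<in> V j" for j u v
  proof -
    have "?N j u v = (\<Sum>i\<in>?I. if i = (j, u, v) then M j u v else 0)"
      unfolding sum_fun_apply by (intro sum.cong refl) (auto simp: unit_block_def split: if_splits)
    also have "\<dots> = M j u v"
    proof -
      have "finite ?I" by (intro finite_SigmaI) auto
      then show ?thesis using juv by simp
    qed
    finally show ?thesis by simp
  qed
  then have "M - ?N \<in> dominated"
    using null_block_zero_entries null_in_psd_mod_null psd_mod_null_subset_dominated by blast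
  moreover have "?N \<in> dominated"
    using diag by (intro is_cone_sum[OF cone]) (auto intro!: unit_block_dominated)
  ultimately have "(M - ?N) + ?N \<in> dominated" by (rule is_cone_add[OF cone])
  then show ?thesis by simp
qed

text \<open>Null tuples lie in the cone with both signs, so \<open>\<mu>\<close> vanishes on them
  and is a combination of the finitely many functionals defining them. Multipliers of words yield
  the moments; those of non-adjacent entries contribute nothing at units on the pattern.\<close>

lemma functional_to_moments:
  assumes lin: "linear \<mu>" and pos: "\<And>M. M \<in> psd_mod_null \<Longrightarrow> \<mu> M \<ge> (0::real)"
  shows "\<exists>y. \<forall>j\<in>{0..m}. \<forall>u\<in>V j. \<forall>v\<in>V j. adj j u v \<longrightarrow> \<mu> (unit_block j u v) = conmat g j y u v"
proof -
  define \<phi> :: "word + nat \<times> word \<times> word \<Rightarrow> blocks \<Rightarrow> real"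
    where "\<phi> i M = (case i of Inl w \<Rightarrow> coef w M + coef (rev w) M | Inr (j, u, v) \<Rightarrow> M j u v + M j v u)"
    for i M
  define N where "N = {(j, u, v). j \<in> {0..m} \<and> u \<in> V j \<and> v \<in> V j \<and> \<not> adj j u v}"
  have "finite N"
  proof (rule finite_subset)
    show "N \<subseteq> (SIGMA j:{0..m}. V j \<times> V j)" by (auto simp: N_def)
  qed auto
  then have fin: "finite (T <+> N)" by simp
  have lin_\<phi>: "linear (\<phi> i)" for i
    unfolding \<phi>_def by (rule linearI) (auto simp: coef_add coef_scale algebra_simps split: sum.split)
  have "\<mu> M = 0" if M: "\<And>i. i \<in> T <+> N \<Longrightarrow> \<phi> i M = 0" for M
  proof -
    have "null_block M"
      unfolding null_block_def
    proof (intro conjI ballI impI)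
      show "coef w M + coef (rev w) M = 0" if "w \<in> T" for w
        using M[of "Inl w"] that by (auto simp: \<phi>_def)
      show "M j u v + M j v u = 0" if "j \<in> {0..m}" "u \<in> V j" "v \<in> V j" "\<not> adj j u v" for j u v
        using M[of "Inr (j, u, v)"] that by (auto simp: \<phi>_def N_def)
    qed
    then have "\<mu> M \<ge> 0" "\<mu> (- M) \<ge> 0"
      using pos null_in_psd_mod_null null_block_minus by blast+
    then show ?thesis using linear_neg[OF lin, of M] by simp
  qed
  then obtain c where c: "\<And>M. \<mu> M = (\<Sum>i\<in>T <+> N. c i * \<phi> i M)"
    using functional_in_span_of_common_kernel[OF fin _ lin, of \<phi>] lin_\<phi> by blast
  define y where "y w = c (Inl w)" for w
  \<comment> \<open>The constraints were symmetrised, so the moment at \<open>w\<close> collects the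
    multipliers of \<open>w\<close> and of \<open>rev w\<close>.\<close>
  have "\<mu> (unit_block j u v) = conmat g j (\<lambda>w. y w + y (rev w)) u v"
    if juv: "j \<in> {0..m}" "u \<in> V j" "v \<in> V j" "adj j u v" for j u v
  proof -
    note sym = gpoly_sym[OF juv(1)]
    have "(\<Sum>i\<in>N. c (Inr i) * \<phi> (Inr i) (unit_block j u v)) = 0"
      using juv(4) by (intro sum.neutral) (auto simp: N_def \<phi>_def unit_block_nonadj)
    then have "\<mu> (unit_block j u v) = (\<Sum>w\<in>T. y w * \<phi> (Inl w) (unit_block j u v))"
      unfolding c using \<open>finite N\<close> by (simp add: sum.Plus y_def)
    also have "\<dots> = (\<Sum>w\<in>T. y w * Dmat g j w u v) + (\<Sum>w\<in>T. y w * Dmat g j w v u)"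
      using juv by (simp add: \<phi>_def coef_unit_block Dmat_rev[OF sym] distrib_left sum.distrib)
    also have "\<dots> = conmat g j y u v + conmat g j y v u"
      using juv adj_commute pattern_sum_Dmat by simp
    also have "\<dots> = conmat g j (\<lambda>w. y w + y (rev w)) u v"
      unfolding conmat_transpose[OF sym, of y v u] by (simp add: conmat_gpoly distrib_left sum.distrib)
    finally show ?thesis .
  qed
  then show ?thesis by blast
qed

text \<open>The form at \<open>x\<close> is the value of \<open>\<mu>\<close> at
  \<open>x x^T\<close> placed in block \<open>j\<close>. The values at units off the pattern supply
  the completion that the primal problem asks for.\<close>

lemma functional_psd:
  assumes lin: "linear \<mu>" and pos: "\<And>M. M \<in> psd_mod_null \<Longrightarrow> \<mu> M \<ge> (0::real)"
    and j: "j \<in> {0..m}"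
  shows "psd_on (V j) (\<lambda>u v. \<mu> (unit_block j u v))"
  unfolding psd_on_def
proof (intro conjI ballI allI)
  fix u v assume "u \<in> V j" "v \<in> V j"
  then have "\<mu> (unit_block j u v - unit_block j v u) \<ge> 0" "\<mu> (unit_block j v u - unit_block j u v) \<ge> 0"
    using null_block_antisym[OF j] pos null_in_psd_mod_null by blast+
  then show "\<mu> (unit_block j u v) = \<mu> (unit_block j v u)"
    by (simp add: linear_diff[OF lin])
next
  fix x
  let ?M = "\<Sum>u\<in>V j. \<Sum>v\<in>V j. (x u * x v) *\<^sub>R unit_block j u v"
  have entry: "?M j' a b = rank_one_block j x j' a b" if "a \<in> V j'" "b \<in> V j'" for j' a b
  proof -
    have "(\<Sum>v\<in>V j. (x u * x v) * unit_block j u v j' a b) =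
        (\<Sum>v\<in>V j. if v = b then (if u = a \<and> j' = j then x a * x b else 0) else 0)" for u
      by (intro sum.cong refl) (auto simp: unit_block_def)
    then have "?M j' a b = (\<Sum>u\<in>V j. if b \<in> V j then (if u = a \<and> j' = j then x a * x b else 0) else 0)"
      using j by (simp add: sum_fun_apply)
    also have "\<dots> = (\<Sum>u\<in>V j. if u = a then (if b \<in> V j \<and> j' = j then x a * x b else 0) else 0)"
      by (intro sum.cong refl) auto
    also have "\<dots> = rank_one_block j x j' a b"
      using j that by (cases "j' = j") (auto simp: rank_one_block_def)
    finally show ?thesis .
  qed
  have "psd_on (V j') (?M j')" for j'
    using psd_on_cong[of "V j'" "?M j'" "rank_one_block j x j'"] entry psd_on_rank_one_block by blast
  then have "?M \<in> psd_mod_null" by (rule psd_in_psd_mod_null)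
  then have "0 \<le> \<mu> ?M" by (rule pos)
  also have "\<mu> ?M = (\<Sum>u\<in>V j. \<Sum>v\<in>V j. x u * \<mu> (unit_block j u v) * x v)"
    by (simp add: linear_sum[OF lin] linear_scale[OF lin] mult_ac)
  finally show "0 \<le> (\<Sum>u\<in>V j. \<Sum>v\<in>V j. x u * \<mu> (unit_block j u v) * x v)" .
qed

text \<open>\<open>X\<close> represents \<open>f - lam\<close> in the moment block. If it lies in
  the cone, its psd representative is dual feasible with value \<open>lam\<close>; if not,
  separation yields a primal feasible \<open>y\<close> with objective at most
  \<open>lam\<close>.\<close>

lemma strong_alternative:
  assumes n: "n \<ge> 1" and m: "m \<ge> 1" and R: "R > 0" and ball: "g 1 = ball_poly n R"
    and f: "is_ncpoly n f" "is_sym f" "deg f \<le> 2 * dh"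
    and f_edge: "\<And>a b. \<lbrakk>rev a @ b \<in> supp f; a \<in> words_upto n dh; b \<in> words_upto n dh; a \<noteq> b\<rbrakk>
      \<Longrightarrow> {a, b} \<in> snd (Gs 0)"
  shows "ereal lam \<le> dual_val n f g m dh Gs \<or> primal_val n f g m Gs \<le> ereal lam"
proof -
  have "\<exists>a b. a \<in> words_upto n dh \<and> b \<in> words_upto n dh \<and> rev a @ b = w" if w: "w \<in> supp f" for w
  proof -
    have "length w \<le> 2 * dh" "set w \<subseteq> {..<n}"
      using length_le_deg[OF f(1) w] f w unfolding is_ncpoly_def by auto
    then show ?thesis by (rule words_upto_split) metis
  qed
  then obtain a b where ab: "\<And>w. w \<in> supp f \<Longrightarrow>
      a w \<in> words_upto n dh \<and> b w \<in> words_upto n dh \<and> rev (a w) @ b w = w" by metis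
  \<comment> \<open>The chosen factorisations stay on the pattern, so \<open>X\<close> will vanish
    off it.\<close>
  have adj: "adj 0 (a w) (b w)" if "w \<in> supp f" for w
    using f_edge[of "a w" "b w"] ab[OF that] that by (auto simp: adj_def)
  define E where "E = unit_block 0 [] []"
  define X where "X = (\<Sum>w\<in>supp f. f w *\<^sub>R unit_block 0 (a w) (b w)) - lam *\<^sub>R E"
  have nil: "[] \<in> words_upto n dh" by (simp add: words_upto_def)
  have finf: "finite (supp f)" using f(1) unfolding is_ncpoly_def by blast
  have coefX: "coef w X = f w - lam * (if w = [] then 1 else 0)" for w
  proof -
    have "coef w (\<Sum>w\<in>supp f. f w *\<^sub>R unit_block 0 (a w) (b w)) =
        (\<Sum>w'\<in>supp f. if w' = w then f w' else 0)"
      unfolding coef_sum coef_scale using ab by (intro sum.cong refl) (auto simp: coef_unit_block Dmat_0)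
    also have "\<dots> = f w" using finf by (simp add: supp_def)
    finally show ?thesis
      using nil by (simp add: X_def E_def coef_diff coef_scale coef_unit_block Dmat_0)
  qed
  show ?thesis
  proof (cases "X \<in> psd_mod_null")
    case True
    then obtain Q where Q: "\<And>j. j \<in> {0..m} \<Longrightarrow> psd_on (V j) (Q j)" "null_block (Q - X)"
      unfolding psd_mod_null_def by blast
    have symQ: "Q j u v = Q j v u" if "j \<in> {0..m}" "u \<in> V j" "v \<in> V j" for j u v
      using Q(1)[OF that(1)] that unfolding psd_on_def by blast
    have "coef w Q + lam * (if w = [] then 1 else 0) = f w" if w: "w \<in> T" for w
    proof -
      \<comment> \<open>As \<open>Q\<close> and \<open>f\<close> are symmetric, this equation is
        twice the wanted one.\<close>
      have "coef w (Q - X) + coef (rev w) (Q - X) = 0" using Q(2) w unfolding null_block_def by blast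
      then show ?thesis
        using coef_rev_symmetric[of Q w] symQ f(2) unfolding is_sym_def coef_diff coefX
        by (auto split: if_splits)
    qed
    moreover have "Q j u v = 0" if juv: "j \<in> {0..m}" "u \<in> V j" "v \<in> V j" "\<not> adj j u v" for j u v
    proof -
      have "X j u v = 0" "X j v u = 0"
        using unit_block_nonadj[OF adj juv(4)] unit_block_nonadj[OF adj_refl juv(4)]
        by (auto simp: X_def E_def sum_fun_apply)
      \<comment> \<open>With \<open>X\<close> zero here, symmetry of \<open>Q\<close> turns this
        into \<open>2 * Q j u v = 0\<close>.\<close>
      moreover have "(Q - X) j u v + (Q - X) j v u = 0"
        using Q(2) juv unfolding null_block_def by blast
      ultimately show ?thesis using symQ[OF juv(1-3)] by simp
    qed
    ultimately have "ereal lam \<le> dual_val n f g m dh Gs"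
      unfolding dual_val_def using Q(1)
      by (intro Sup_upper CollectI exI[of _ lam] conjI refl exI[of _ Q])
        (auto simp: coef_def adj_def pattern_words_def)
    then show ?thesis by blast
  next
    case False
    have "\<exists>t. t *\<^sub>R E + M \<in> psd_mod_null" for M
      using dominated_UNIV[OF n m R ball, of M] unfolding dominated_def E_def by blast
    moreover have "E \<in> psd_mod_null"
      unfolding E_def rank_one_block_indicator by (rule rank_one_in_psd_mod_null)
    ultimately obtain \<mu> :: "blocks \<Rightarrow> real" where \<mu>: "linear \<mu>" "\<And>M. M \<in> psd_mod_null \<Longrightarrow> \<mu> M \<ge> 0"
      "\<mu> E = 1" "\<mu> X \<le> 0"
      using cone_separation_order_unit[OF is_cone_psd_mod_null _ _ False, of E] by blast
    obtain y where y: "\<And>j u v. \<lbrakk>j \<in> {0..m}; u \<in> V j; v \<in> V j; adj j u v\<rbrakk> \<Longrightarrow>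
        \<mu> (unit_block j u v) = conmat g j y u v"
      using functional_to_moments[OF \<mu>(1,2)] by blast
    have moment: "\<mu> (unit_block 0 a b) = y (rev a @ b)"
      if "a \<in> words_upto n dh" "b \<in> words_upto n dh" "adj 0 a b" for a b
      using y[of 0 a b] that by (simp add: conmat_def momat_def)
    have "y [] = 1" using moment[OF nil nil] \<mu>(3) by (simp add: E_def)
    moreover have "\<forall>j\<in>{0..m}. \<exists>Q. psd_on (V j) Q \<and>
        (\<forall>u\<in>V j. \<forall>v\<in>V j. u = v \<or> {u, v} \<in> snd (Gs j) \<longrightarrow> Q u v = conmat g j y u v)"
    proof
      fix j assume j: "j \<in> {0..m}"
      show "\<exists>Q. psd_on (V j) Q \<and>
          (\<forall>u\<in>V j. \<forall>v\<in>V j. u = v \<or> {u, v} \<in> snd (Gs j) \<longrightarrow> Q u v = conmat g j y u v)"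
        using functional_psd[OF \<mu>(1,2) j] y[OF j] unfolding adj_def by blast
    qed
    ultimately have "primal_val n f g m Gs \<le> ereal (Lfun y f)"
      unfolding primal_val_def by (intro Inf_lower) blast
    also have "Lfun y f = (\<Sum>w\<in>supp f. f w * \<mu> (unit_block 0 (a w) (b w)))"
      unfolding Lfun_def using moment ab adj by (intro sum.cong refl) simp
    also have "\<dots> = \<mu> X + lam"
      unfolding X_def using \<mu>(3)
      by (simp add: linear_diff[OF \<mu>(1)] linear_sum[OF \<mu>(1)] linear_scale[OF \<mu>(1)])
    also have "ereal \<dots> \<le> ereal lam" using \<mu>(4) by simp
    finally show ?thesis by blast
  qed
qed

text \<open>A strict gap contains a real \<open>lam\<close>, even between infinite values, and this
  contradicts the alternative.\<close>

lemma no_duality_gap: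
  assumes "n \<ge> 1" "m \<ge> 1" "R > 0" "g 1 = ball_poly n R"
    and "is_ncpoly n f" "is_sym f" "deg f \<le> 2 * dh" "supp f \<subseteq> T"
    and "\<And>a b. \<lbrakk>rev a @ b \<in> supp f; a \<in> words_upto n dh; b \<in> words_upto n dh; a \<noteq> b\<rbrakk>
      \<Longrightarrow> {a, b} \<in> snd (Gs 0)"
  shows "primal_val n f g m Gs = dual_val n f g m dh Gs"
proof (rule antisym)
  show "dual_val n f g m dh Gs \<le> primal_val n f g m Gs"
    using assms(8) by (rule weak_duality)
  show "primal_val n f g m Gs \<le> dual_val n f g m dh Gs"
  proof (rule ccontr)
    assume "\<not> primal_val n f g m Gs \<le> dual_val n f g m dh Gs"
    then obtain lam where "dual_val n f g m dh Gs < ereal lam" "ereal lam < primal_val n f g m Gs"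
      using ereal_dense2[of "dual_val n f g m dh Gs" "primal_val n f g m Gs"] by (auto simp: not_le)
    then show False
      using strong_alternative[OF assms(1-7) assms(9), of lam] by (auto simp: not_le[symmetric])
  qed
qed

end

text \<open>For \<open>k \<ge> 1\<close> the graphs arise from a preceding stage, and every
  factorisation of a pattern word of that stage into distinct words is an edge of the moment graph
  at stage \<open>k\<close>.\<close>

lemma tsgraph_no_duality_gap:
  assumes ext: "monotone_ext ext" and n: "n \<ge> 1" and m: "m \<ge> 1"
    and R: "R > 0" and ball: "g 1 = ball_poly n R"
    and f: "is_ncpoly n f" "is_sym f"
    and g: "\<forall>j\<in>{1..m}. is_ncpoly n (g j) \<and> is_sym (g j)"
    and dh: "dh \<ge> dmin f g m" and k: "k \<ge> 1"
  shows "lam_ts ext n f g m dh k = lam_ts_dual ext n f g m dh k"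
proof -
  let ?G = "tsgraph ext n f g m dh"
  obtain l where l: "k = Suc l" using k by (cases k) auto
  have V: "fst (?G k j) = words_upto n (dh - dj g j)" for k j
    by (rule graph_wf_tsgraph(2)[OF ext])
  have gp: "is_ncpoly n (gpoly g j) \<and> is_sym (gpoly g j)" if "j \<in> {0..m}" for j
  proof (cases "j = 0")
    case True
    then show ?thesis by (simp add: is_ncpoly_def) (simp add: is_sym_def ncone_def)
  next
    case False
    then show ?thesis using that g by (simp add: gpoly_pos)
  qed
  interpret sparsity_pattern n m dh g "?G k"
  proof
    show "is_ncpoly n (gpoly g j)" "is_sym (gpoly g j)" if "j \<in> {0..m}" for j
      using gp[OF that] by auto
    show "graph_wf (?G k j)" for j by (rule graph_wf_tsgraph(1)[OF ext])
    show "fst (?G k j) = words_upto n (dh - dj g j)" for j by (rule V)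
    show "dj g j \<le> dh" if "j \<in> {0..m}" for j
      using dj_le_dmin[OF that, of g f] dh by simp
    show "{a, b} \<in> snd (?G k 0)"
      if j: "j \<in> {0..m}" and u: "u \<in> fst (?G k j)" and w: "w \<in> supp (gpoly g j)"
        and eq: "rev a @ b = rev u @ w @ u"
        and ab: "a \<in> words_upto n dh" "b \<in> words_upto n dh" "a \<noteq> b" for j u w a b
    proof -
      \<comment> \<open>Stage \<open>l\<close> has the same vertices and \<open>gsupp\<close> counts
        diagonal entries, so the word is already in its pattern.\<close>
      have "rev u @ w @ u \<in> pattern_words n g m dh (?G l)"
        using j u w V by (intro pattern_wordsI[of j]) auto
      then show ?thesis
        using pattern_word_edge_Suc[OF ext _ ab] eq unfolding l by metis
    qed
  qed
  show ?thesis
    unfolding lam_ts_def lam_ts_dual_def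
  proof (rule no_duality_gap[OF n m R ball f])
    show "deg f \<le> 2 * dh" using deg_le_dmin[of f g m] dh by simp
    show "supp f \<subseteq> T" by (rule supp_subset_pattern_words[OF ext f(1) dh])
    fix a b assume "rev a @ b \<in> supp f" and ab: "a \<in> words_upto n dh" "b \<in> words_upto n dh" "a \<noteq> b"
    then have "rev a @ b \<in> pattern_words n g m dh (?G l)"
      using supp_subset_pattern_words[OF ext f(1) dh] by blast
    then show "{a, b} \<in> snd (?G k 0)"
      using pattern_word_edge_Suc[OF ext _ ab] unfolding l by blast
  qed
qed

theorem theorem3p3:
  fixes n m :: nat and f :: ncpoly and g :: "nat \<Rightarrow> ncpoly" and ext :: "wgraph \<Rightarrow> wgraph"
  assumes "n \<ge> 1"
    and "is_ncpoly n f" and "is_sym f"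
    and "\<forall>j\<in>{1..m}. is_ncpoly n (g j) \<and> is_sym (g j)"
    and "chordal_ext_rule ext"
  shows
    "(feasible n g m \<and> m \<ge> 1 \<and> (\<exists>R>0. g 1 = ball_poly n R) \<longrightarrow>
        (\<forall>dh\<ge>dmin f g m. \<forall>k\<ge>1. lam_ts ext n f g m dh k = lam_ts_dual ext n f g m dh k))
   \<and> (\<forall>dh\<ge>dmin f g m. \<forall>k\<ge>1.
        lam_ts ext n f g m dh k \<le> lam_ts ext n f g m dh (Suc k) \<and>
        lam_ts ext n f g m dh k \<le> dense_val n f g m dh)
   \<and> (\<forall>k\<ge>1. \<forall>dh\<ge>dmin f g m. lam_ts ext n f g m dh k \<le> lam_ts ext n f g m (Suc dh) k)
   \<and> (\<forall>dh\<ge>dmin f g m.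
        (\<exists>K\<ge>1. \<forall>k\<ge>K. lam_ts max_chordal_ext n f g m dh k = dense_val n f g m dh) \<and>
        lam_ts_circ max_chordal_ext n f g m dh = dense_val n f g m dh)"
proof -
  have ext: "monotone_ext ext"
    using assms(5) by (rule chordal_ext_rule_imp_monotone_ext)
  have fin: "finite (fst (tsgraph ext n f g m dh k j))" for dh k j
    by (simp add: graph_wf_tsgraph(2)[OF ext])
  have "lam_ts ext n f g m dh k = lam_ts_dual ext n f g m dh k"
    if "m \<ge> 1" "R > 0" "g 1 = ball_poly n R" "dh \<ge> dmin f g m" "k \<ge> 1" for R dh k
    using tsgraph_no_duality_gap[OF ext assms(1) that(1-3) assms(2-4) that(4,5)] .
  moreover have "lam_ts ext n f g m dh k \<le> lam_ts ext n f g m dh (Suc k)" for dh k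
    unfolding lam_ts_def using tsgraph_subgraph_Suc[OF ext] fin by (rule primal_val_mono)
  moreover have "lam_ts ext n f g m dh k \<le> dense_val n f g m dh" for dh k
    unfolding lam_ts_def using graph_wf_tsgraph(2)[OF ext] by (rule primal_val_le_dense_val)
  moreover have "lam_ts ext n f g m dh k \<le> lam_ts ext n f g m (Suc dh) k" for dh k
    unfolding lam_ts_def using tsgraph_mono_order[OF ext le_SucI[OF order_refl]] fin
    by (rule primal_val_mono)
  ultimately show ?thesis
    using max_chordal_ext_reaches_dense_val[OF assms(2)] by blast
qed

end
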